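(* There exists a polynomial-time $O(\log^2 k)$-approximation algorithm for the connected $k$-center problem with disjoint clusters and for the connected $k$-diameter problem with disjoint clusters (for arbitrary metrics and arbitrary connectivity graphs).
   Context: An instance consists of a finite point set $V$, a metric $d$ on $V$, an integer $k\ge1$, and an unweighted undirected connectivity graph $G=(V,E)$. A feasible solution (disjoint clusters) is a partition of $V$ into $k$ clusters $C_1,\dots,C_k$, each inducing a connected subgraph of $G$. For connected $k$-center, centers $c_i\in C_i$ are also chosen and the cost is $\max_i\max_{x\in C_i}d(x,c_i)$; for connected $k$-diameter the cost is $\max_i\max_{x,y\in C_i}d(x,y)$. The cost is to be minimized; an $\alpha$-approximation algorithm returns a feasible solution with cost at most $\alpha$ times optimal. *)

theory Defs
  imports
    "HOL-Analysis.Abstract_Metric_Spaces"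
    "HOL-Computational_Algebra.Polynomial"
    "HOL-Library.Disjoint_Sets"
    "HOL-Library.Landau_Symbols"
    "Graph_Theory.Graph_Theory"
begin

section \<open>Connected clustering with disjoint clusters\<close>

text \<open>
  The point set of an instance is the vertex set of its connectivity graph. The locale
  \<open>pair_graph\<close> describes finite simple undirected graphs (as symmetric arc relations).
  Note that \<open>Metric_space\<close> constrains the sign and symmetry of \<open>d\<close> also outside the carrier;
  this is no restriction, as a metric on the points can be extended by 0.
\<close>

definition clustering_instance :: "'a pair_pre_digraph \<Rightarrow> ('a \<Rightarrow> 'a \<Rightarrow> real) \<Rightarrow> nat \<Rightarrow> bool" where
  "clustering_instance G d k \<longleftrightarrow> pair_graph G \<and> Metric_space (pverts G) d \<and> k \<ge> 1"

text \<open>Analysis has a topological notion called \<open>connected\<close> too, hence the qualified name.\<close>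

definition connected_partition :: "'a pair_pre_digraph \<Rightarrow> nat \<Rightarrow> (nat \<Rightarrow> 'a set) \<Rightarrow> bool" where
  "connected_partition G k C \<longleftrightarrow>
     (\<Union>i\<in>{1..k}. C i) = pverts G \<and> disjoint_family_on C {1..k} \<and>
     (\<forall>i\<in>{1..k}. C i \<noteq> {} \<and> Digraph_Component.connected (with_proj G \<restriction> C i))"

definition centered_partition ::
    "'a pair_pre_digraph \<Rightarrow> nat \<Rightarrow> (nat \<Rightarrow> 'a set) \<Rightarrow> (nat \<Rightarrow> 'a) \<Rightarrow> bool" where
  "centered_partition G k C c \<longleftrightarrow> connected_partition G k C \<and> (\<forall>i\<in>{1..k}. c i \<in> C i)"

definition center_cost ::
    "('a \<Rightarrow> 'a \<Rightarrow> real) \<Rightarrow> nat \<Rightarrow> (nat \<Rightarrow> 'a set) \<Rightarrow> (nat \<Rightarrow> 'a) \<Rightarrow> real" where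
  "center_cost d k C c = (MAX i\<in>{1..k}. MAX x\<in>C i. d x (c i))"

definition diameter_cost :: "('a \<Rightarrow> 'a \<Rightarrow> real) \<Rightarrow> nat \<Rightarrow> (nat \<Rightarrow> 'a set) \<Rightarrow> real" where
  "diameter_cost d k C = (MAX i\<in>{1..k}. MAX x\<in>C i. MAX y\<in>C i. d x y)"

text \<open>The optima are only meaningful if a feasible solution exists; the infima are then minima.\<close>

definition center_opt :: "'a pair_pre_digraph \<Rightarrow> ('a \<Rightarrow> 'a \<Rightarrow> real) \<Rightarrow> nat \<Rightarrow> real" where
  "center_opt G d k = Inf {center_cost d k C c | C c. centered_partition G k C c}"

definition diameter_opt :: "'a pair_pre_digraph \<Rightarrow> ('a \<Rightarrow> 'a \<Rightarrow> real) \<Rightarrow> nat \<Rightarrow> real" where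
  "diameter_opt G d k = Inf {diameter_cost d k C | C. connected_partition G k C}"


section \<open>Machine model\<close>

text \<open>
  Algorithms are programs of a random access machine with one memory for natural numbers and one
  for real numbers, the latter holding distances. Every cell has an address \<open>(x, i, j)\<close>, where
  \<open>x\<close> is the name of a two-dimensional array and the indices \<open>i\<close>, \<open>j\<close> are computed at run time;
  a scalar is a cell \<open>(x, 0, 0)\<close>. All cells are unbounded.

  Every assignment and every test takes unit time (the size of an expression is fixed by the
  program). For this to be a reasonable measure, arithmetic is limited to addition and
  subtraction: there is no multiplication, division or rounding, no conversion between the two
  memories, and no real constant other than 0. Hence after \<open>t\<close> steps a natural number has
  \<open>O(t)\<close> bits more than the natural numbers in the input, and a real number is a linear
  combination of input distances whose integer coefficients have \<open>O(t)\<close> bits. In particular,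
  programs that run in polynomial time in this model run in polynomial time on a Turing machine
  when the distances are rationals given in binary.
\<close>

type_synonym addr = "string \<times> nat \<times> nat"

record state =
  nmem :: "addr \<Rightarrow> nat"
  rmem :: "addr \<Rightarrow> real"

datatype nexp = NConst nat | NCell string nexp nexp | NAdd nexp nexp | NSub nexp nexp

datatype rexp = RZero | RCell string nexp nexp | RAdd rexp rexp | RSub rexp rexp

datatype bexp = NLess nexp nexp | RLess rexp rexp | BNot bexp | BAnd bexp bexp

datatype com =
    Skip
  | NAssign string nexp nexp nexp
  | RAssign string nexp nexp rexp
  | Seq com com
  | If bexp com com
  | While bexp com

text \<open>Subtraction of natural numbers is truncated at 0.\<close>

primrec nval :: "nexp \<Rightarrow> state \<Rightarrow> nat" where
  "nval (NConst m) s = m"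
| "nval (NCell x a b) s = nmem s (x, nval a s, nval b s)"
| "nval (NAdd a b) s = nval a s + nval b s"
| "nval (NSub a b) s = nval a s - nval b s"

primrec rval :: "rexp \<Rightarrow> state \<Rightarrow> real" where
  "rval RZero s = 0"
| "rval (RCell x a b) s = rmem s (x, nval a s, nval b s)"
| "rval (RAdd a b) s = rval a s + rval b s"
| "rval (RSub a b) s = rval a s - rval b s"

primrec bval :: "bexp \<Rightarrow> state \<Rightarrow> bool" where
  "bval (NLess a b) s \<longleftrightarrow> nval a s < nval b s"
| "bval (RLess a b) s \<longleftrightarrow> rval a s < rval b s"
| "bval (BNot b) s \<longleftrightarrow> \<not> bval b s"
| "bval (BAnd a b) s \<longleftrightarrow> bval a s \<and> bval b s"

text \<open>\<open>exec c s t s'\<close>: started in \<open>s\<close>, the program \<open>c\<close> halts in \<open>s'\<close> after \<open>t\<close> steps.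
  The semantics is deterministic.\<close>

inductive exec :: "com \<Rightarrow> state \<Rightarrow> nat \<Rightarrow> state \<Rightarrow> bool" where
  Skip: "exec Skip s 1 s"
| NAssign: "exec (NAssign x a b e) s 1
    (s\<lparr>nmem := (nmem s)((x, nval a s, nval b s) := nval e s)\<rparr>)"
| RAssign: "exec (RAssign x a b e) s 1
    (s\<lparr>rmem := (rmem s)((x, nval a s, nval b s) := rval e s)\<rparr>)"
| Seq: "exec c1 s1 t1 s2 \<Longrightarrow> exec c2 s2 t2 s3 \<Longrightarrow> exec (Seq c1 c2) s1 (t1 + t2) s3"
| IfTrue: "bval b s \<Longrightarrow> exec c1 s t s' \<Longrightarrow> exec (If b c1 c2) s (t + 1) s'"
| IfFalse: "\<not> bval b s \<Longrightarrow> exec c2 s t s' \<Longrightarrow> exec (If b c1 c2) s (t + 1) s'"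
| WhileFalse: "\<not> bval b s \<Longrightarrow> exec (While b c) s 1 s"
| WhileTrue: "bval b s1 \<Longrightarrow> exec c s1 t1 s2 \<Longrightarrow> exec (While b c) s2 t2 s3 \<Longrightarrow>
    exec (While b c) s1 (t1 + t2 + 1) s3"


section \<open>Polynomial-time approximation algorithms\<close>

text \<open>
  The points of an input are numbered \<open>0, \<dots>, n - 1\<close>. The program gets \<open>n\<close>, \<open>k\<close>, the adjacency
  matrix and the distance matrix; all other cells are 0.
\<close>

definition input :: "nat \<Rightarrow> nat pair_pre_digraph \<Rightarrow> (nat \<Rightarrow> nat \<Rightarrow> real) \<Rightarrow> nat \<Rightarrow> state" where
  "input n G d k =
    \<lparr>nmem = (\<lambda>(x, i, j).
       if x = ''n'' \<and> i = 0 \<and> j = 0 then n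
       else if x = ''k'' \<and> i = 0 \<and> j = 0 then k
       else if x = ''adj'' \<and> (i, j) \<in> parcs G then 1
       else 0),
     rmem = (\<lambda>(x, i, j). if x = ''dist'' \<and> i < n \<and> j < n then d i j else 0)\<rparr>"

text \<open>
  A program outputs a cluster index in \<open>{1..k}\<close> for every point and, for \<open>k\<close>-center, a center
  for every cluster index.
\<close>

definition output_cluster :: "nat \<Rightarrow> state \<Rightarrow> nat \<Rightarrow> nat set" where
  "output_cluster n s i = {v. v < n \<and> nmem s (''cluster'', v, 0) = i}"

definition output_center :: "state \<Rightarrow> nat \<Rightarrow> nat" where
  "output_center s i = nmem s (''center'', i, 0)"

text \<open>
  The input consists of \<open>k\<close> and \<open>\<Theta>(n\<^sup>2)\<close> further numbers; the time bound depends on \<open>n\<close> only.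
  Programs have to halt within this bound on all instances, also on those without a feasible
  solution.
\<close>

definition polynomial_time :: "com \<Rightarrow> bool" where
  "polynomial_time P \<longleftrightarrow> (\<exists>p :: nat poly. \<forall>n G d k.
     clustering_instance G d k \<and> pverts G = {..<n} \<longrightarrow>
     (\<exists>t s. exec P (input n G d k) t s \<and> t \<le> poly p n))"

text \<open>The approximation ratio may depend on \<open>k\<close>.\<close>

definition approximates_center :: "com \<Rightarrow> (nat \<Rightarrow> real) \<Rightarrow> bool" where
  "approximates_center P \<alpha> \<longleftrightarrow> (\<forall>n G d k t s.
     clustering_instance G d k \<and> pverts G = {..<n} \<and>
     (\<exists>C c. centered_partition G k C c) \<and> exec P (input n G d k) t s \<longrightarrow>
     centered_partition G k (output_cluster n s) (output_center s) \<and>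
     center_cost d k (output_cluster n s) (output_center s) \<le> \<alpha> k * center_opt G d k)"

definition approximates_diameter :: "com \<Rightarrow> (nat \<Rightarrow> real) \<Rightarrow> bool" where
  "approximates_diameter P \<alpha> \<longleftrightarrow> (\<forall>n G d k t s.
     clustering_instance G d k \<and> pverts G = {..<n} \<and>
     (\<exists>C. connected_partition G k C) \<and> exec P (input n G d k) t s \<longrightarrow>
     connected_partition G k (output_cluster n s) \<and>
     diameter_cost d k (output_cluster n s) \<le> \<alpha> k * diameter_opt G d k)"

end

theory Submission
  imports Defs "HOL-Real_Asymp.Real_Asymp"
begin

text \<open>
  The algorithm guesses the smallest distance \<open>\<rho>\<close> for which a greedy choice of points \<open>c\<close>, each
  covering the component \<open>T\<^sub>c\<close> of \<open>c\<close> in the subgraph induced by the ball of radius \<open>\<rho>\<close> around \<open>c\<close>,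
  covers everything with at most \<open>k\<close> points. The largest diameter of the clusters of any feasible
  solution is a distance with this property, since the greedy choice takes at most one point of each
  cluster. Hence \<open>\<rho>\<close> is at most the optimal diameter and at most twice the optimal radius.

  The components \<open>T\<^sub>c\<close> overlap. To separate them, \<open>k\<close> centers start with singleton clusters, and the
  centers are treated in layers. In a layer, a ball of radius \<open>2\<rho>j\<close> around an active center is
  enlarged while a step of \<open>2\<rho>\<close> more than doubles the number of active centers in it, hence
  \<open>j \<le> log\<^sub>2 k\<close>; the centers in the final ball form a group and those in the next shell are postponed
  to later layers, which are no more than the grouped ones. So the number of ungrouped centers
  halves in every layer, and there are at most \<open>log\<^sub>2 k + 1\<close> layers. For every group, the existing
  clusters are extended along edges inside the union of the \<open>\<rho>\<close>-balls around its centers. This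
  union contains the components \<open>T\<^sub>c\<close> of the group, has diameter \<open>O(\<rho> log k)\<close> and is disjoint from
  the unions of the other groups in the layer. Therefore every layer increases the radius of the
  clusters by \<open>O(\<rho> log k)\<close> only, which gives \<open>O(\<rho> log\<^sup>2 k)\<close> in total.
\<close>

section \<open>Counting loops\<close>

abbreviation Scalar :: "string \<Rightarrow> nexp" where
  "Scalar a \<equiv> NCell a (NConst 0) (NConst 0)"

abbreviation Entry :: "string \<Rightarrow> nexp \<Rightarrow> nexp" where
  "Entry a e \<equiv> NCell a e (NConst 0)"

abbreviation RScalar :: "string \<Rightarrow> rexp" where
  "RScalar a \<equiv> RCell a (NConst 0) (NConst 0)"

abbreviation Dist :: "string \<Rightarrow> string \<Rightarrow> rexp" where
  "Dist x y \<equiv> RCell ''dist'' (Scalar x) (Scalar y)"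

abbreviation set_scalar :: "string \<Rightarrow> nexp \<Rightarrow> com" where
  "set_scalar a e \<equiv> NAssign a (NConst 0) (NConst 0) e"

abbreviation set_entry :: "string \<Rightarrow> nexp \<Rightarrow> nexp \<Rightarrow> com" where
  "set_entry a i e \<equiv> NAssign a i (NConst 0) e"

abbreviation set_rscalar :: "string \<Rightarrow> rexp \<Rightarrow> com" where
  "set_rscalar a e \<equiv> RAssign a (NConst 0) (NConst 0) e"

abbreviation positive :: "nexp \<Rightarrow> bexp" where
  "positive e \<equiv> NLess (NConst 0) e"

abbreviation put :: "string \<Rightarrow> nat \<Rightarrow> state \<Rightarrow> state" where
  "put x m s \<equiv> s\<lparr>nmem := (nmem s)((x, 0, 0) := m)\<rparr>"

text \<open>All loops of the algorithm have this form, which makes it polynomial. Processes that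
  would end by themselves, such as saturating labels, enlarging a radius or exhausting the ungrouped
  centers, also get \<open>n\<close> rounds; once such a process has ended, further rounds are
  idle.\<close>

definition For :: "string \<Rightarrow> com \<Rightarrow> com" where
  "For x c = Seq (set_scalar x (NConst 0))
     (While (NLess (Scalar x) (Scalar ''n''))
       (Seq c (set_scalar x (NAdd (Scalar x) (NConst 1)))))"

section \<open>Frame conditions by array name\<close>

primrec nwrites :: "com \<Rightarrow> string set" where
  "nwrites Skip = {}"
| "nwrites (NAssign x a b e) = {x}"
| "nwrites (RAssign x a b e) = {}"
| "nwrites (Seq c1 c2) = nwrites c1 \<union> nwrites c2"
| "nwrites (If b c1 c2) = nwrites c1 \<union> nwrites c2"
| "nwrites (While b c) = nwrites c"

primrec rwrites :: "com \<Rightarrow> string set" where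
  "rwrites Skip = {}"
| "rwrites (NAssign x a b e) = {}"
| "rwrites (RAssign x a b e) = {x}"
| "rwrites (Seq c1 c2) = rwrites c1 \<union> rwrites c2"
| "rwrites (If b c1 c2) = rwrites c1 \<union> rwrites c2"
| "rwrites (While b c) = rwrites c"

lemma writes_For [simp]:
  "nwrites (For x c) = insert x (nwrites c)" "rwrites (For x c) = rwrites c"
  by (auto simp: For_def)

definition unchanged :: "string set \<Rightarrow> string set \<Rightarrow> state \<Rightarrow> state \<Rightarrow> bool" where
  "unchanged X Y s s' \<longleftrightarrow>
     (\<forall>a i j. a \<notin> X \<longrightarrow> nmem s' (a, i, j) = nmem s (a, i, j)) \<and>
     (\<forall>a i j. a \<notin> Y \<longrightarrow> rmem s' (a, i, j) = rmem s (a, i, j))"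

lemma unchangedD:
  assumes "unchanged X Y s s'"
  shows "a \<notin> X \<Longrightarrow> nmem s' (a, i, j) = nmem s (a, i, j)"
    and "a \<notin> Y \<Longrightarrow> rmem s' (a, i, j) = rmem s (a, i, j)"
  using assms by (auto simp: unchanged_def)

lemma unchanged_trans:
  "unchanged X Y s s' \<Longrightarrow> unchanged X Y s' s'' \<Longrightarrow> unchanged X Y s s''"
  by (simp add: unchanged_def)

lemma unchanged_mono:
  "unchanged X Y s s' \<Longrightarrow> X \<subseteq> X' \<Longrightarrow> Y \<subseteq> Y' \<Longrightarrow> unchanged X' Y' s s'"
  by (auto simp: unchanged_def)

section \<open>Partial correctness of programs\<close>

definition run :: "com \<Rightarrow> state \<Rightarrow> state \<Rightarrow> bool" where
  "run c s s' \<longleftrightarrow> (\<exists>t. exec c s t s')"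

inductive_cases exec_SkipE: "exec Skip s t s'"
inductive_cases exec_NAssignE: "exec (NAssign x a b e) s t s'"
inductive_cases exec_RAssignE: "exec (RAssign x a b e) s t s'"
inductive_cases exec_SeqE: "exec (Seq c1 c2) s t s'"
inductive_cases exec_IfE: "exec (If b c1 c2) s t s'"
inductive_cases exec_WhileE: "exec (While b c) s t s'"

lemma run_simps [simp]:
  "run Skip s s' \<longleftrightarrow> s' = s"
  "run (NAssign x a b e) s s' \<longleftrightarrow> s' = s\<lparr>nmem := (nmem s)((x, nval a s, nval b s) := nval e s)\<rparr>"
  "run (RAssign x a b r) s s' \<longleftrightarrow> s' = s\<lparr>rmem := (rmem s)((x, nval a s, nval b s) := rval r s)\<rparr>"
  "run (Seq c1 c2) s s' \<longleftrightarrow> (\<exists>s1. run c1 s s1 \<and> run c2 s1 s')"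
  "run (If be c1 c2) s s' \<longleftrightarrow> (if bval be s then run c1 s s' else run c2 s s')"
  unfolding run_def
  by (auto elim!: exec_SkipE exec_NAssignE exec_RAssignE exec_SeqE exec_IfE intro: exec.intros)

lemma run_unchanged: "run c s s' \<Longrightarrow> unchanged (nwrites c) (rwrites c) s s'"
proof -
  have "exec c s t s' \<Longrightarrow> unchanged (nwrites c) (rwrites c) s s'" for t
    by (induction rule: exec.induct) (auto simp: unchanged_def)
  then show "run c s s' \<Longrightarrow> unchanged (nwrites c) (rwrites c) s s'"
    by (auto simp: run_def)
qed

text \<open>Hoare rule for partial correctness: halting is contained in the hypothesis
  \<open>run\<close>, so an invariant suffices.\<close>

lemma run_While_induct:
  assumes "run (While b c) s s'" and "J s"
    and "\<And>s1 s2. J s1 \<Longrightarrow> bval b s1 \<Longrightarrow> run c s1 s2 \<Longrightarrow> J s2"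
  shows "J s' \<and> \<not> bval b s'"
proof -
  have "exec w s t s' \<Longrightarrow> w = While b c \<Longrightarrow> J s \<Longrightarrow> J s' \<and> \<not> bval b s'" for w t
  proof (induction rule: exec.induct)
    case (WhileTrue b' s1 c' t1 s2 t2 s3)
    then show ?case using assms(3) by (auto simp: run_def)
  qed auto
  with assms(1,2) show ?thesis by (auto simp: run_def)
qed

text \<open>The invariant gets the value of the counter as an argument and must, by
  \<open>put\<close>, be insensitive to the cell that stores it. Each iteration is entered with a
  frame condition relative to the initial state \<open>s\<close>, so facts about \<open>s\<close>
  stay available in the body.\<close>

lemma run_For:
  assumes run: "run (For x c) s s'"
    and n: "nmem s (''n'', 0, 0) = n"
    and x: "x \<notin> nwrites c" "''n'' \<notin> insert x (nwrites c)"
    and I0: "I 0 s"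
    and put: "\<And>i s m. I i s \<Longrightarrow> I i (put x m s)"
    and step: "\<And>i s1 s2. i < n \<Longrightarrow> nmem s1 (x, 0, 0) = i \<Longrightarrow> run c s1 s2 \<Longrightarrow>
      unchanged (insert x (nwrites c)) (rwrites c) s s1 \<Longrightarrow> I i s1 \<Longrightarrow> I (Suc i) s2"
  shows "I n s' \<and> unchanged (insert x (nwrites c)) (rwrites c) s s'"
proof -
  let ?U = "unchanged (insert x (nwrites c)) (rwrites c) s"
  let ?J = "\<lambda>s1. nmem s1 (x, 0, 0) \<le> n \<and> ?U s1 \<and> I (nmem s1 (x, 0, 0)) s1"
  have n': "nmem s1 (''n'', 0, 0) = n" if "?U s1" for s1
    using n x(2) that by (auto simp: unchanged_def)
  have "?J s' \<and> \<not> bval (NLess (Scalar x) (Scalar ''n'')) s'"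
  proof (rule run_While_induct)
    show "run (While (NLess (Scalar x) (Scalar ''n''))
        (Seq c (set_scalar x (NAdd (Scalar x) (NConst 1))))) (put x 0 s) s'"
      using run by (simp add: For_def)
    show "?J (put x 0 s)"
      using put[OF I0] by (auto simp: unchanged_def)
  next
    fix s1 s2
    assume J: "?J s1" and b: "bval (NLess (Scalar x) (Scalar ''n'')) s1"
      and r: "run (Seq c (set_scalar x (NAdd (Scalar x) (NConst 1)))) s1 s2"
    have lt: "nmem s1 (x, 0, 0) < n" using J b n' by auto
    from r obtain s1' where s1': "run c s1 s1'"
      and s2: "s2 = put x (nmem s1' (x, 0, 0) + 1) s1'" by auto
    have u: "unchanged (nwrites c) (rwrites c) s1 s1'" using run_unchanged[OF s1'] .
    then have same: "nmem s1' (x, 0, 0) = nmem s1 (x, 0, 0)"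
      using x by (auto simp: unchanged_def)
    have "I (Suc (nmem s1 (x, 0, 0))) s1'" using step[OF lt refl s1'] J by auto
    then have "I (Suc (nmem s1 (x, 0, 0))) s2" unfolding s2 by (rule put)
    moreover have "?U s1'"
      using J unchanged_trans unchanged_mono[OF u] by blast
    ultimately show "?J s2" using lt same s2 by (auto simp: unchanged_def)
  qed
  with n' show ?thesis by auto
qed

section \<open>Running time of loop programs\<close>

text \<open>In a program whose loops are all bounded by the number of points, the running time is bounded
  independently of the remaining contents of the memory.\<close>

definition polytime :: "com \<Rightarrow> bool" where
  "polytime c \<longleftrightarrow> ''n'' \<notin> nwrites c \<and>
     (\<exists>p :: nat poly. \<forall>s. \<exists>t s'. exec c s t s' \<and> t \<le> poly p (nmem s (''n'', 0, 0)))"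

lemma polytimeI:
  assumes "''n'' \<notin> nwrites c" "\<And>s. \<exists>t s'. exec c s t s' \<and> t \<le> poly p (nmem s (''n'', 0, 0))"
  shows "polytime c"
  using assms unfolding polytime_def by blast

lemma polytime_Skip: "polytime Skip"
  by (rule polytimeI[of _ 1]) (auto intro!: exI exec.intros)

lemma polytime_NAssign: "x \<noteq> ''n'' \<Longrightarrow> polytime (NAssign x a b e)"
  by (rule polytimeI[of _ 1]) (auto intro!: exI exec.intros)

lemma polytime_RAssign: "polytime (RAssign x a b e)"
  by (rule polytimeI[of _ 1]) (auto intro!: exI exec.intros)

lemma exec_n_unchanged:
  "exec c s t s' \<Longrightarrow> ''n'' \<notin> nwrites c \<Longrightarrow> nmem s' (''n'', 0, 0) = nmem s (''n'', 0, 0)"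
  using run_unchanged by (meson run_def unchangedD(1))

lemma polytime_Seq:
  assumes "polytime c1" "polytime c2"
  shows "polytime (Seq c1 c2)"
proof -
  from assms obtain p1 p2 :: "nat poly" where
    1: "\<And>s. \<exists>t s'. exec c1 s t s' \<and> t \<le> poly p1 (nmem s (''n'', 0, 0))" and
    2: "\<And>s. \<exists>t s'. exec c2 s t s' \<and> t \<le> poly p2 (nmem s (''n'', 0, 0))"
    unfolding polytime_def by metis
  show ?thesis
  proof (rule polytimeI[of _ "p1 + p2"])
    fix s
    obtain t1 s1 where e1: "exec c1 s t1 s1" "t1 \<le> poly p1 (nmem s (''n'', 0, 0))"
      using 1 by blast
    obtain t2 s2 where e2: "exec c2 s1 t2 s2" "t2 \<le> poly p2 (nmem s1 (''n'', 0, 0))"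
      using 2 by blast
    have "nmem s1 (''n'', 0, 0) = nmem s (''n'', 0, 0)"
      using exec_n_unchanged[OF e1(1)] assms(1) by (simp add: polytime_def)
    with e1 e2 show "\<exists>t s'. exec (Seq c1 c2) s t s' \<and> t \<le> poly (p1 + p2) (nmem s (''n'', 0, 0))"
      by (intro exI[of _ "t1 + t2"] exI[of _ s2]) (auto intro: exec.Seq)
  qed (use assms in \<open>auto simp: polytime_def\<close>)
qed

lemma polytime_If:
  assumes "polytime c1" "polytime c2"
  shows "polytime (If b c1 c2)"
proof -
  from assms obtain p1 p2 :: "nat poly" where
    1: "\<And>s. \<exists>t s'. exec c1 s t s' \<and> t \<le> poly p1 (nmem s (''n'', 0, 0))" and
    2: "\<And>s. \<exists>t s'. exec c2 s t s' \<and> t \<le> poly p2 (nmem s (''n'', 0, 0))"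
    unfolding polytime_def by metis
  show ?thesis
  proof (rule polytimeI[of _ "p1 + p2 + 1"])
    fix s
    obtain t1 s1 where e1: "exec c1 s t1 s1" "t1 \<le> poly p1 (nmem s (''n'', 0, 0))"
      using 1 by blast
    obtain t2 s2 where e2: "exec c2 s t2 s2" "t2 \<le> poly p2 (nmem s (''n'', 0, 0))"
      using 2 by blast
    show "\<exists>t s'. exec (If b c1 c2) s t s' \<and> t \<le> poly (p1 + p2 + 1) (nmem s (''n'', 0, 0))"
    proof (cases "bval b s")
      case True
      with e1 show ?thesis
        by (intro exI[of _ "t1 + 1"] exI[of _ s1] conjI exec.IfTrue) auto
    next
      case False
      with e2 show ?thesis
        by (intro exI[of _ "t2 + 1"] exI[of _ s2] conjI exec.IfFalse) auto
    qed
  qed (use assms in \<open>auto simp: polytime_def\<close>)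
qed

lemma polytime_For:
  assumes c: "polytime c" and x: "x \<notin> nwrites c" "x \<noteq> ''n''"
  shows "polytime (For x c)"
proof -
  from c obtain p :: "nat poly" where
    p: "\<And>s. \<exists>t s'. exec c s t s' \<and> t \<le> poly p (nmem s (''n'', 0, 0))"
    unfolding polytime_def by metis
  let ?W = "While (NLess (Scalar x) (Scalar ''n''))
    (Seq c (set_scalar x (NAdd (Scalar x) (NConst 1))))"
  \<comment> \<open>Here \<open>d\<close> is the number of iterations left. Each costs the body, the
    increment and the test; the final 1 is the failing test.\<close>
  have W: "\<exists>t s'. exec ?W s t s' \<and> t \<le> d * (poly p n + 2) + 1"
    if "nmem s (''n'', 0, 0) = n" "nmem s (x, 0, 0) + d = n" for s d n
    using that
  proof (induction d arbitrary: s)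
    case 0
    then show ?case
      by (intro exI[of _ 1] exI[of _ s] conjI exec.WhileFalse) auto
  next
    case (Suc d)
    obtain t1 s1 where e1: "exec c s t1 s1" "t1 \<le> poly p n" using p Suc.prems by metis
    have n1: "nmem s1 (''n'', 0, 0) = n"
      using exec_n_unchanged[OF e1(1)] c Suc.prems by (simp add: polytime_def)
    have x1: "nmem s1 (x, 0, 0) = nmem s (x, 0, 0)"
      using run_unchanged[of c s s1] e1 x by (auto simp: run_def unchanged_def)
    let ?s2 = "put x (Suc (nmem s (x, 0, 0))) s1"
    obtain t3 s3 where e3: "exec ?W ?s2 t3 s3" "t3 \<le> d * (poly p n + 2) + 1"
      using Suc.IH[of ?s2] Suc.prems n1 x by auto
    have "exec (set_scalar x (NAdd (Scalar x) (NConst 1))) s1 1 ?s2"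
      using exec.NAssign[of x "NConst 0" "NConst 0" "NAdd (Scalar x) (NConst 1)" s1] x1 by simp
    note exec.Seq[OF e1(1) this]
    then have "exec ?W s (t1 + 1 + t3 + 1) s3"
      using e3 Suc.prems by (intro exec.WhileTrue) auto
    then show ?case using e1 e3 by (intro exI conjI) auto
  qed
  \<comment> \<open>The polynomial \<open>[:0, 1:]\<close> evaluates to \<open>n\<close>; the last 2
    pays for the initialization and the failing test.\<close>
  show ?thesis
  proof (rule polytimeI[of _ "[:0, 1:] * (p + 2) + 2"])
    fix s :: state
    define n where "n = nmem s (''n'', 0, 0)"
    obtain t s' where e: "exec ?W (put x 0 s) t s'" "t \<le> n * (poly p n + 2) + 1"
      using W[of "put x 0 s" n n] x by (auto simp: n_def)
    have "exec (For x c) s (1 + t) s'"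
      unfolding For_def
      by (rule exec.Seq[OF _ e(1)])
        (use exec.NAssign[of x "NConst 0" "NConst 0" "NConst 0" s] in simp)
    then show "\<exists>t s'. exec (For x c) s t s' \<and>
        t \<le> poly ([:0, 1:] * (p + 2) + 2) (nmem s (''n'', 0, 0))"
      using e(2) unfolding n_def[symmetric] by (intro exI conjI) auto
  qed (use c x in \<open>auto simp: polytime_def\<close>)
qed

lemmas polytime_intros = polytime_Skip polytime_NAssign polytime_RAssign
  polytime_Seq polytime_If polytime_For

section \<open>Clusterings of a fixed instance\<close>

locale clustering =
  fixes n :: nat and G :: "nat pair_pre_digraph" and d :: "nat \<Rightarrow> nat \<Rightarrow> real" and k :: nat
  assumes clustering_instance: "clustering_instance G d k" and pverts_eq: "pverts G = {..<n}"
begin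

lemma k_pos: "1 \<le> k"
  using clustering_instance by (simp add: clustering_instance_def)

lemma parcs_less: "(x, y) \<in> parcs G \<Longrightarrow> x < n" "(x, y) \<in> parcs G \<Longrightarrow> y < n"
  and parcs_sym: "(x, y) \<in> parcs G \<Longrightarrow> (y, x) \<in> parcs G"
proof -
  interpret pair_graph G using clustering_instance by (simp add: clustering_instance_def)
  show "(x, y) \<in> parcs G \<Longrightarrow> x < n" "(x, y) \<in> parcs G \<Longrightarrow> y < n"
    using in_arcsD1 in_arcsD2 pverts_eq by auto
  show "(x, y) \<in> parcs G \<Longrightarrow> (y, x) \<in> parcs G"
    using pair_sym_arcs unfolding symmetric_def by (auto dest: symD)
qed

lemma metric: "Metric_space {..<n} d"
  using clustering_instance pverts_eq by (simp add: clustering_instance_def)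

lemma d_nonneg: "0 \<le> d x y"
  using Metric_space.nonneg[OF metric] .

lemma d_commute: "d x y = d y x"
  using Metric_space.commute[OF metric] .

lemma d_refl: "x < n \<Longrightarrow> d x x = 0"
  using Metric_space.zero[OF metric] by auto

lemma d_triangle: "x < n \<Longrightarrow> y < n \<Longrightarrow> z < n \<Longrightarrow> d x z \<le> d x y + d y z"
  using Metric_space.triangle[OF metric] by auto

section \<open>Connectedness and growth of labels along edges\<close>

abbreviation reach :: "nat set \<Rightarrow> nat rel" where
  "reach S \<equiv> rtrancl_on S (parcs G)"

definition linked :: "nat set \<Rightarrow> bool" where
  "linked S \<longleftrightarrow> (\<forall>u\<in>S. \<forall>v\<in>S. (u, v) \<in> reach S)"

lemma reach_sym: "(u, v) \<in> reach S \<Longrightarrow> (v, u) \<in> reach S"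
  by (induction rule: rtrancl_on_induct)
    (auto intro: converse_rtrancl_on_into_rtrancl_on parcs_sym)

lemma reach_mono: "(u, v) \<in> reach S \<Longrightarrow> S \<subseteq> S' \<Longrightarrow> (u, v) \<in> reach S'"
  by (meson order_refl rtrancl_on_mono)

text \<open>Connectedness of a digraph is strong connectedness of its symmetric closure. The arcs
  are symmetric already, and walks counted by \<open>reach S\<close> never leave \<open>S\<close>,
  so neither the closure nor the restriction of the arcs changes reachability.\<close>

lemma connected_iff_linked:
  "Digraph_Component.connected (with_proj G \<restriction> S) \<longleftrightarrow> S \<noteq> {} \<and> linked S"
proof -
  have arcs: "arcs_ends (with_proj (mk_symmetric (with_proj G \<restriction> S))) = parcs G \<inter> S \<times> S"
    by (auto simp: arcs_ends_def arc_to_ends_def mk_symmetric_def intro: parcs_sym)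
  have "rtrancl_on S (parcs G \<inter> S \<times> S) = reach S"
  proof (intro equalityI subrelI)
    fix u v assume "(u, v) \<in> reach S"
    then show "(u, v) \<in> rtrancl_on S (parcs G \<inter> S \<times> S)"
      by (induction rule: rtrancl_on_induct) (auto intro: rtrancl_on_into_rtrancl_on)
  qed (meson inf_le1 order_refl rtrancl_on_mono subsetD)
  then show ?thesis
    unfolding Digraph_Component.connected_def strongly_connected_def reachable_def arcs linked_def
    by (simp add: mk_symmetric_def)
qed

text \<open>Label 0 means unlabelled. Growth is a relation, so its consequences hold for every order
  in which a program scans the edges.\<close>

definition grow_step :: "nat set \<Rightarrow> (nat \<Rightarrow> nat) \<Rightarrow> (nat \<Rightarrow> nat) \<Rightarrow> bool" where
  "grow_step W f g \<longleftrightarrow>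
     (\<exists>x y. (x, y) \<in> parcs G \<and> x \<in> W \<and> y \<in> W \<and> 0 < f x \<and> f y = 0 \<and> g = f(y := f x))"

definition saturated :: "nat set \<Rightarrow> (nat \<Rightarrow> nat) \<Rightarrow> bool" where
  "saturated W f \<longleftrightarrow> (\<forall>x\<in>W. \<forall>y\<in>W. (x, y) \<in> parcs G \<longrightarrow> 0 < f x \<longrightarrow> 0 < f y)"

definition saturates :: "nat set \<Rightarrow> (nat \<Rightarrow> nat) \<Rightarrow> (nat \<Rightarrow> nat) \<Rightarrow> bool" where
  "saturates W f g \<longleftrightarrow> (grow_step W)\<^sup>*\<^sup>* f g \<and> saturated W g"

abbreviation part :: "(nat \<Rightarrow> nat) \<Rightarrow> nat \<Rightarrow> nat set" where
  "part f i \<equiv> {x. x < n \<and> f x = i}"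

lemma grow_keeps:
  assumes "(grow_step W)\<^sup>*\<^sup>* f g" "0 < f x"
  shows "g x = f x"
  using assms by (induction rule: rtranclp_induct) (auto simp: grow_step_def)

text \<open>Following a new label backwards stays in \<open>W\<close> and ends at a point that
  carried it from the start. Together with the diameter of \<open>W\<close> this bounds how far a
  label travels.\<close>

lemma grow_source:
  assumes "(grow_step W)\<^sup>*\<^sup>* f g" "0 < g x" "f x = 0"
  shows "x \<in> W \<and> (\<exists>p\<in>W. p < n \<and> 0 < f p \<and> f p = g x)"
  using assms
proof (induction arbitrary: x rule: rtranclp_induct)
  case (step g h)
  then obtain u v where uv: "(u, v) \<in> parcs G" "u \<in> W" "v \<in> W" "0 < g u" "g v = 0"
    "h = g(v := g u)" by (auto simp: grow_step_def)
  \<comment> \<open>The point \<open>u\<close> that passes its label on either had this label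
    initially or, by induction, obtained it from a point that did.\<close>
  have "0 < f u \<longrightarrow> f u = g u" using grow_keeps[OF step.hyps(1)] by simp
  with uv step.IH[of u] step.IH[of x] step.prems parcs_less(1)[OF uv(1)] show ?case
    by (cases "x = v"; cases "f u = 0") auto
qed simp

text \<open>A new point is attached to its cluster by the edge that passed the label; symmetry of
  the edges gives the walks back.\<close>

lemma grow_linked:
  assumes "(grow_step W)\<^sup>*\<^sup>* f g" "0 < i" "linked (part f i)"
  shows "linked (part g i)"
  using assms
proof (induction rule: rtranclp_induct)
  case (step g h)
  then obtain u v where uv: "(u, v) \<in> parcs G" "0 < g u" "g v = 0" "h = g(v := g u)"
    by (auto simp: grow_step_def)
  have less: "u < n" "v < n" using parcs_less uv by auto
  have l: "linked (part g i)" using step by auto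
  show ?case
  proof (cases "g u = i")
    case False
    then have "part h i = part g i" using uv step.prems by auto
    with l show ?thesis by simp
  next
    case True
    then have h: "part h i = insert v (part g i)" using uv less by auto
    have *: "(x, y) \<in> reach (part h i)" if "x \<in> part g i" "y \<in> part g i" for x y
      using l that unfolding linked_def h by (meson reach_mono subset_insertI)
    have u: "u \<in> part g i" using True less by simp
    have v: "(x, v) \<in> reach (part h i)" if "x \<in> part g i" for x
      using *[OF that u] uv(1) h by (auto intro: rtrancl_on_into_rtrancl_on)
    show ?thesis
      unfolding linked_def
      using * v reach_sym[OF v] h by (auto intro: rtrancl_on_refl)
  qed
qed

lemma saturated_reach:
  assumes "saturated W f" "(u, x) \<in> reach W" "0 < f u"
  shows "0 < f x"
  using assms(2,3,1)
  by (induction rule: rtrancl_on_induct) (auto simp: saturated_def)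

section \<open>Components of balls and the greedy cover\<close>

abbreviation ball :: "nat \<Rightarrow> real \<Rightarrow> nat set" where
  "ball v r \<equiv> {x. x < n \<and> d v x \<le> r}"

definition comp :: "real \<Rightarrow> nat \<Rightarrow> nat set" where
  "comp r v = {x. (v, x) \<in> reach (ball v r)}"

lemma comp_self: "v < n \<Longrightarrow> 0 \<le> r \<Longrightarrow> v \<in> comp r v"
  by (simp add: comp_def d_refl)

text \<open>Growth labels only points reachable from \<open>v\<close> inside the ball, and
  saturation carries the label of \<open>v\<close> along every walk in the ball.\<close>

lemma saturates_comp:
  assumes "saturates (ball v r) (\<lambda>x. if x = v then 1 else 0) g" "v < n" "0 \<le> r"
  shows "{x. 0 < g x} = comp r v"
proof (intro equalityI subsetI)
  let ?f = "\<lambda>x. if x = v then 1 else 0 :: nat"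
  fix x assume "x \<in> {x. 0 < g x}"
  moreover have "(grow_step (ball v r))\<^sup>*\<^sup>* ?f g" using assms by (simp add: saturates_def)
  then have "\<forall>x. 0 < g x \<longrightarrow> x \<in> comp r v"
  proof (induction rule: rtranclp_induct)
    case base
    then show ?case using comp_self assms by auto
  next
    case (step g h)
    then obtain x y where xy: "(x, y) \<in> parcs G" "y \<in> ball v r" "0 < g x" "h = g(y := g x)"
      by (auto simp: grow_step_def)
    then have "(v, x) \<in> reach (ball v r)" using step.IH by (simp add: comp_def)
    then have "y \<in> comp r v"
      unfolding comp_def using xy(1,2) by (simp add: rtrancl_on_into_rtrancl_on)
    with step.IH xy show ?case by auto
  qed
  ultimately show "x \<in> comp r v" by blast
next
  fix x assume "x \<in> comp r v"
  moreover have "0 < g v" using grow_keeps assms by (fastforce simp: saturates_def)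
  ultimately show "x \<in> {x. 0 < g x}"
    using saturated_reach assms unfolding saturates_def comp_def by blast
qed

primrec greedy_set :: "real \<Rightarrow> nat \<Rightarrow> nat set" where
  "greedy_set r 0 = {}"
| "greedy_set r (Suc i) =
     (if i \<in> \<Union> (comp r ` greedy_set r i) then greedy_set r i else insert i (greedy_set r i))"

lemma greedy_set_subset: "greedy_set r i \<subseteq> {..<i}"
  by (induction i) auto

text \<open>The separation is one-sided: a point is tested only against those chosen before it, and
  \<open>v \<in> comp r u\<close> need not be symmetric, because the two balls differ.\<close>

lemma greedy_set_separated:
  "u \<in> greedy_set r i \<Longrightarrow> v \<in> greedy_set r i \<Longrightarrow> u < v \<Longrightarrow> v \<notin> comp r u"
proof (induction i)
  case (Suc i)
  then show ?case using greedy_set_subset[of r i] by (auto split: if_splits)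
qed simp

lemma greedy_set_covers:
  assumes "0 \<le> r" "i \<le> n"
  shows "{..<i} \<subseteq> \<Union> (comp r ` greedy_set r i)"
  using assms(2)
proof (induction i)
  case (Suc i)
  then show ?case using comp_self[of i r] assms(1) by (auto simp: lessThan_Suc)
qed simp

lemma finite_greedy_set [simp]: "finite (greedy_set r i)"
  using greedy_set_subset finite_subset by blast

text \<open>A cluster of diameter at most \<open>r\<close> is contained in \<open>comp r v\<close> for each of its points \<open>v\<close>, so
  the greedy choice takes at most one point of it.\<close>

lemma card_greedy_set:
  assumes C: "connected_partition G k C"
    and diam: "\<And>i x y. i \<in> {1..k} \<Longrightarrow> x \<in> C i \<Longrightarrow> y \<in> C i \<Longrightarrow> d x y \<le> r"
  shows "card (greedy_set r n) \<le> k"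
proof -
  have cover: "(\<Union>i\<in>{1..k}. C i) = {..<n}" using C pverts_eq by (simp add: connected_partition_def)
  have "\<forall>v\<in>greedy_set r n. \<exists>i\<in>{1..k}. v \<in> C i"
    using greedy_set_subset[of r n] cover by blast
  then obtain h where h: "\<And>v. v \<in> greedy_set r n \<Longrightarrow> h v \<in> {1..k} \<and> v \<in> C (h v)"
    by metis
  have eq: "v \<in> comp r u" if "u \<in> greedy_set r n" "v \<in> greedy_set r n" "h u = h v" for u v
  proof -
    have i: "h u \<in> {1..k}" and uv: "u \<in> C (h u)" "v \<in> C (h u)" using h that by metis+
    have "linked (C (h u))" using C i connected_iff_linked by (auto simp: connected_partition_def)
    then have "(u, v) \<in> reach (C (h u))" using uv by (auto simp: linked_def)
    moreover have "C (h u) \<subseteq> ball u r" using diam[OF i uv(1)] cover i by auto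
    ultimately show ?thesis unfolding comp_def using reach_mono by blast
  qed
  have "inj_on h (greedy_set r n)"
  proof (rule inj_onI)
    fix u v assume *: "u \<in> greedy_set r n" "v \<in> greedy_set r n" "h u = h v"
    then show "u = v"
      using eq greedy_set_separated by (metis linorder_neqE_nat)
  qed
  then have "card (greedy_set r n) \<le> card {1..k}"
    using h by (intro card_inj_on_le) auto
  then show ?thesis by simp
qed

section \<open>Partial clusterings of bounded radius\<close>

definition clustered :: "(nat \<Rightarrow> nat) \<Rightarrow> (nat \<Rightarrow> nat) \<Rightarrow> real \<Rightarrow> bool" where
  "clustered z f b \<longleftrightarrow>
     (\<forall>i\<in>{1..k}. z i < n \<and> f (z i) = i \<and> linked (part f i)) \<and>
     (\<forall>x<n. 0 < f x \<longrightarrow> f x \<le> k \<and> d x (z (f x)) \<le> b)"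

lemma clustered_mono: "clustered z f b \<Longrightarrow> b \<le> b' \<Longrightarrow> clustered z f b'"
  unfolding clustered_def by force

text \<open>\<open>clustered\<close> leaves points of label 0 unconstrained, so that it fits
  intermediate states. Once all labels are positive, it describes a solution of radius
  \<open>b\<close>.\<close>

lemma centered_partition_clustered:
  assumes c: "clustered z f b" and pos: "\<And>x. x < n \<Longrightarrow> 0 < f x"
  shows "centered_partition G k (part f) z" "center_cost d k (part f) z \<le> b"
    "diameter_cost d k (part f) \<le> 2 * b"
proof -
  have z: "z i < n" "f (z i) = i" "linked (part f i)" if "i \<in> {1..k}" for i
    using c that by (auto simp: clustered_def)
  have f: "f x \<in> {1..k}" "d x (z (f x)) \<le> b" if "x < n" for x
    using c pos that by (force simp: clustered_def)+
  have ne: "part f i \<noteq> {}" if "i \<in> {1..k}" for i using z[OF that] by auto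
  show "centered_partition G k (part f) z"
    unfolding centered_partition_def connected_partition_def
    using f z ne by (auto simp: connected_iff_linked pverts_eq disjoint_family_on_def)
  have fin: "finite (part f i)" for i by simp
  have k: "{1..k} \<noteq> {}" using k_pos by simp
  show "center_cost d k (part f) z \<le> b"
    unfolding center_cost_def using k ne f fin by auto
  have "d x y \<le> 2 * b" if "x < n" "y < n" "f x = f y" for x y
  proof -
    have "z (f x) < n" using z f that by blast
    then have "d x y \<le> d x (z (f x)) + d (z (f x)) y" using d_triangle[of x "z (f x)" y] that by simp
    then show ?thesis using f[of x] f[of y] that d_commute[of y] by simp
  qed
  then show "diameter_cost d k (part f) \<le> 2 * b"
    unfolding diameter_cost_def using k ne fin by auto
qed

text \<open>New labels come from points of \<open>W\<close>, whose labels agree with the older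
  clustering \<open>f0\<close>. Hence they start from the older bound \<open>b0\<close>, and several
  growths in disjoint regions increase the radius by \<open>D\<close> only once.\<close>

lemma clustered_grow:
  assumes f: "clustered z f b" and f0: "clustered z f0 b0"
    and grow: "(grow_step W)\<^sup>*\<^sup>* f g"
    and old: "\<And>x. x \<in> W \<Longrightarrow> f x = f0 x"
    and W: "W \<subseteq> {..<n}" "\<And>x y. x \<in> W \<Longrightarrow> y \<in> W \<Longrightarrow> d x y \<le> D"
    and b: "b0 + D \<le> b"
  shows "clustered z g b"
  unfolding clustered_def
proof (intro conjI ballI allI impI)
  fix i assume i: "i \<in> {1..k}"
  then show "z i < n" "g (z i) = i" "linked (part g i)"
    using f grow_keeps[OF grow, of "z i"] grow_linked[OF grow, of i]
    by (auto simp: clustered_def)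
next
  fix x assume x: "x < n" "0 < g x"
  have "g x \<le> k \<and> d x (z (g x)) \<le> b"
  proof (cases "f x = 0")
    case False
    then show ?thesis using f x grow_keeps[OF grow] by (auto simp: clustered_def)
  next
    case True
    then obtain p where p: "x \<in> W" "p \<in> W" "p < n" "0 < f p" "f p = g x"
      using grow_source[OF grow x(2)] by auto
    \<comment> \<open>The source \<open>p\<close> of the label has it under \<open>f0\<close>
      already, so its distance to the center is at most \<open>b0\<close>.\<close>
    then have "f0 p = g x" using old by auto
    then have *: "g x \<le> k" "d p (z (g x)) \<le> b0" using f0 p x by (auto simp: clustered_def)
    then have "z (g x) < n" using f0 x by (auto simp: clustered_def)
    then have "d x (z (g x)) \<le> d x p + d p (z (g x))" using d_triangle[of x p "z (g x)"] x p by simp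
    then show ?thesis using * W(2)[OF p(1,2)] b by auto
  qed
  then show "g x \<le> k" "d x (z (g x)) \<le> b" by auto
qed

section \<open>Forming one group of a layer\<close>

text \<open>The state inside a layer: \<open>f0\<close> and \<open>A0\<close> are the labels and the ungrouped centers at its
  beginning, \<open>al\<close> are the centers still ungrouped and \<open>ac\<close> those of them not postponed to later
  layers. The balls around \<open>ac\<close> are untouched since the beginning of the layer.\<close>

definition layer_inv :: "real \<Rightarrow> nat set \<Rightarrow> (nat \<Rightarrow> nat) \<Rightarrow> real \<Rightarrow> (nat \<Rightarrow> nat) \<Rightarrow> nat set \<Rightarrow>
    (nat \<Rightarrow> nat) \<Rightarrow> nat set \<Rightarrow> nat set \<Rightarrow> bool" where
  "layer_inv r S z b f0 A0 f al ac \<longleftrightarrow>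
     clustered z f b \<and>
     (\<forall>x<n. \<forall>u\<in>ac. d u x \<le> r \<longrightarrow> f x = f0 x) \<and>
     ac \<subseteq> al \<and> al \<subseteq> A0 \<and> A0 \<subseteq> S \<and>
     card (al - ac) \<le> card (A0 - al) \<and>
     (\<forall>u\<in>S. 0 < f u) \<and>
     (\<forall>u\<in>S - al. \<forall>x\<in>comp r u. 0 < f x)"

text \<open>The group \<open>B\<close> has radius \<open>R\<close> around \<open>v\<close>, and
  \<open>B'\<close> adds a shell of width \<open>2 * r\<close> that is postponed. The shell keeps
  the region \<open>W\<close> away from the balls of all centers that stay active, and
  \<open>small\<close> charges the postponed centers to the grouped ones.\<close>

lemma layer_inv_group:
  assumes inv: "layer_inv r S z b f0 A0 f al ac" and S: "S \<subseteq> {..<n}"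
    and f0: "clustered z f0 b0" and b: "b0 + 2 * (R + r) \<le> b"
    and v: "v \<in> ac"
    and B: "B = {u \<in> ac. d v u \<le> R}" and B': "B' = {u \<in> ac. d v u \<le> R + r + r}"
    and small: "card B' \<le> 2 * card B" and r: "0 \<le> r"
    and W: "W = {x. x < n \<and> (\<exists>u\<in>B. d u x \<le> r)}" and g: "saturates W f g"
  shows "layer_inv r S z b f0 A0 g (al - B) (ac - B')"
proof -
  have sub: "ac \<subseteq> al" "al \<subseteq> A0" "A0 \<subseteq> S" using inv by (auto simp: layer_inv_def)
  with S have ac: "\<And>u. u \<in> ac \<Longrightarrow> u < n" by blast
  have fin: "finite A0" "finite al" "finite ac" using sub S by (meson finite_lessThan finite_subset)+
  have BB': "B \<subseteq> B'" "B' \<subseteq> ac" using B B' r by auto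
  have grow: "(grow_step W)\<^sup>*\<^sup>* f g" and sat: "saturated W g" using g by (auto simp: saturates_def)
  \<comment> \<open>The centers in \<open>B\<close> were active until now, so their balls are
    untouched since the beginning of the layer.\<close>
  have old: "f x = f0 x" if "x \<in> W" for x
    using inv that B unfolding W layer_inv_def by blast
  have diam: "d x y \<le> 2 * (R + r)" if xy: "x \<in> W" "y \<in> W" for x y
  proof -
    have near: "d v x \<le> R + r" if x: "x \<in> W" for x
    proof -
      obtain u where u: "u \<in> ac" "d v u \<le> R" "d u x \<le> r" "x < n" using x W B by auto
      then have "d v x \<le> d v u + d u x" using d_triangle[of v u x] v ac by simp
      with u show ?thesis by simp
    qed
    have "x < n" "y < n" "v < n" using xy v ac W by auto
    then have "d x y \<le> d x v + d v y" using d_triangle[of x v y] by simp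
    then show ?thesis using near[OF xy(1)] near[OF xy(2)] d_commute[of x v] by simp
  qed
  have "clustered z g b"
    using inv by (intro clustered_grow[OF _ f0 grow old _ diam b]) (auto simp: layer_inv_def W)
  \<comment> \<open>A new label at \<open>x\<close> means that \<open>x\<close> is within
    \<open>r\<close> of some \<open>u\<close> in \<open>B\<close>. A center \<open>w\<close> within
    \<open>r\<close> of \<open>x\<close> then has distance at most \<open>R + r + r\<close> from
    \<open>v\<close> and belongs to \<open>B'\<close>.\<close>
  moreover have "g x = f0 x" if x: "x < n" "w \<in> ac - B'" "d w x \<le> r" for x w
  proof (rule ccontr)
    assume ne: "g x \<noteq> f0 x"
    have fx: "f x = f0 x" using inv x unfolding layer_inv_def by blast
    then have "f x = 0" "0 < g x" using ne grow_keeps[OF grow, of x] by (cases "f x"; auto)+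
    then have "x \<in> W" using grow_source[OF grow] by blast
    then obtain u where u: "u \<in> ac" "d v u \<le> R" "d u x \<le> r" using W B by auto
    have "v < n" "u < n" "w < n" using v u x ac by auto
    then have "d v w \<le> d v u + d u w" "d u w \<le> d u x + d x w"
      using d_triangle[of v u w] d_triangle[of u x w] x by simp_all
    then have "d v w \<le> R + r + r" using u x d_commute[of w x] by simp
    then show False using x B' by auto
  qed
  \<comment> \<open>\<open>B' - B\<close> joins the postponed centers and \<open>B\<close> the
    grouped ones; \<open>small\<close> says that the former is no larger than the latter.\<close>
  moreover have "card ((al - B) - (ac - B')) \<le> card (A0 - (al - B))"
  proof -
    have "(al - B) - (ac - B') = (al - ac) \<union> (B' - B)" using BB' sub by auto
    then have "card ((al - B) - (ac - B')) \<le> card (al - ac) + card (B' - B)"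
      by (simp add: card_Un_le)
    also have "card (B' - B) \<le> card B"
      using small BB' fin by (simp add: card_Diff_subset finite_subset)
    also have "card (al - ac) \<le> card (A0 - al)" using inv by (simp add: layer_inv_def)
    also have "card (A0 - al) + card B = card ((A0 - al) \<union> B)"
      using BB' sub fin by (intro card_Un_disjoint[symmetric]) (auto intro: finite_subset)
    also have "(A0 - al) \<union> B = A0 - (al - B)" using BB' sub by auto
    finally show ?thesis by simp
  qed
  moreover have pos: "0 < g u" if "u \<in> S" for u
    using inv that grow_keeps[OF grow, of u] by (auto simp: layer_inv_def)
  \<comment> \<open>For a center newly grouped, the whole ball lies in \<open>W\<close>, so
    saturation carries a label from the center through its component. Other components keep their
    labels.\<close>
  moreover have "0 < g x" if u: "u \<in> S - (al - B)" and x: "x \<in> comp r u" for u x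
  proof (cases "u \<in> B")
    case True
    have "ball u r \<subseteq> W" using True W by auto
    then have "(u, x) \<in> reach W" using x reach_mono unfolding comp_def by blast
    then show ?thesis using saturated_reach[OF sat] pos u by blast
  next
    case False
    then have "0 < f x" using u x inv unfolding layer_inv_def by blast
    then show ?thesis using grow_keeps[OF grow, of x] by auto
  qed
  ultimately show ?thesis using sub BB' unfolding layer_inv_def by blast
qed

end

section \<open>Growing labels along edges\<close>

definition propagate_step :: com where
  "propagate_step =
     If (BAnd (BAnd (positive (Entry ''cluster'' (Scalar ''x'')))
              (BNot (positive (Entry ''cluster'' (Scalar ''y'')))))
          (BAnd (positive (NCell ''adj'' (Scalar ''x'') (Scalar ''y'')))
            (BAnd (positive (Entry ''w'' (Scalar ''x''))) (positive (Entry ''w'' (Scalar ''y''))))))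
       (set_entry ''cluster'' (Scalar ''y'') (Entry ''cluster'' (Scalar ''x''))) Skip"

definition propagate_round :: com where
  "propagate_round = For ''x'' (For ''y'' propagate_step)"

definition propagate :: com where
  "propagate = For ''round'' propagate_round"

lemma writes_propagate [simp]:
  "nwrites propagate_step = {''cluster''}" "rwrites propagate_step = {}"
  "nwrites propagate_round = {''x'', ''y'', ''cluster''}" "rwrites propagate_round = {}"
  "nwrites propagate = {''round'', ''x'', ''y'', ''cluster''}" "rwrites propagate = {}"
  by (auto simp: propagate_step_def propagate_round_def propagate_def)

context clustering
begin

section \<open>Memory arrays as functions and as sets of points\<close>

definition vec :: "state \<Rightarrow> string \<Rightarrow> nat \<Rightarrow> nat" where
  "vec s a = (\<lambda>x. if x < n then nmem s (a, x, 0) else 0)"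

definition supp :: "state \<Rightarrow> string \<Rightarrow> nat set" where
  "supp s a = {x. x < n \<and> 0 < nmem s (a, x, 0)}"

lemma vec_update [simp]:
  "a \<noteq> b \<Longrightarrow> vec (s\<lparr>nmem := f((b, i, j) := m)\<rparr>) a = vec (s\<lparr>nmem := f\<rparr>) a"
  "i < n \<Longrightarrow> vec (s\<lparr>nmem := f((a, i, 0) := m)\<rparr>) a = (vec (s\<lparr>nmem := f\<rparr>) a)(i := m)"
  "vec (s\<lparr>nmem := nmem s\<rparr>) a = vec s a"
  "vec (s\<lparr>rmem := r\<rparr>) a = vec s a"
  by (auto simp: vec_def)

lemma supp_update [simp]:
  "a \<noteq> b \<Longrightarrow> supp (s\<lparr>nmem := f((b, i, j) := m)\<rparr>) a = supp (s\<lparr>nmem := f\<rparr>) a"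
  "i < n \<Longrightarrow> supp (s\<lparr>nmem := f((a, i, 0) := m)\<rparr>) a =
    (if 0 < m then insert i (supp (s\<lparr>nmem := f\<rparr>) a) else supp (s\<lparr>nmem := f\<rparr>) a - {i})"
  "supp (s\<lparr>nmem := nmem s\<rparr>) a = supp s a"
  "supp (s\<lparr>rmem := r\<rparr>) a = supp s a"
  by (auto simp: supp_def)

lemma vec_unchanged: "unchanged X Y s s' \<Longrightarrow> a \<notin> X \<Longrightarrow> vec s' a = vec s a"
  and supp_unchanged: "unchanged X Y s s' \<Longrightarrow> a \<notin> X \<Longrightarrow> supp s' a = supp s a"
  by (auto simp: vec_def supp_def unchanged_def)

lemma vec_pos_iff: "0 < vec s a x \<longleftrightarrow> x \<in> supp s a"
  by (simp add: vec_def supp_def)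

lemma supp_less: "supp s a \<subseteq> {..<n}" "finite (supp s a)"
  by (auto simp: supp_def)

definition holds_instance :: "state \<Rightarrow> bool" where
  "holds_instance s \<longleftrightarrow> nmem s (''n'', 0, 0) = n \<and> nmem s (''k'', 0, 0) = k \<and>
     (\<forall>i j. 0 < nmem s (''adj'', i, j) \<longleftrightarrow> (i, j) \<in> parcs G) \<and>
     (\<forall>i<n. \<forall>j<n. rmem s (''dist'', i, j) = d i j)"

lemma holds_instance_unchanged:
  "holds_instance s \<Longrightarrow> unchanged X Y s s' \<Longrightarrow> X \<inter> {''n'', ''k'', ''adj''} = {} \<Longrightarrow>
    ''dist'' \<notin> Y \<Longrightarrow> holds_instance s'"
  unfolding holds_instance_def unchanged_def by auto

lemma propagate_step_correct:
  assumes s: "holds_instance s" and run: "run propagate_step s s'"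
    and x: "nmem s (''x'', 0, 0) = x" "x < n" and y: "nmem s (''y'', 0, 0) = y" "y < n"
  shows "(grow_step (supp s ''w''))\<^sup>*\<^sup>* (vec s ''cluster'') (vec s' ''cluster'') \<and>
    (x \<in> supp s ''w'' \<longrightarrow> y \<in> supp s ''w'' \<longrightarrow> (x, y) \<in> parcs G \<longrightarrow> 0 < vec s ''cluster'' x \<longrightarrow>
      0 < vec s' ''cluster'' y)"
proof (cases "0 < vec s ''cluster'' x \<and> vec s ''cluster'' y = 0 \<and> (x, y) \<in> parcs G \<and>
    x \<in> supp s ''w'' \<and> y \<in> supp s ''w''")
  case True
  then have s': "s' = s\<lparr>nmem := (nmem s)((''cluster'', y, 0) := nmem s (''cluster'', x, 0))\<rparr>"
    using run s x y by (simp add: propagate_step_def holds_instance_def vec_def supp_def)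
  then have eq: "vec s' ''cluster'' = (vec s ''cluster'')(y := vec s ''cluster'' x)"
    unfolding s' using x y by (auto simp: vec_def)
  have "grow_step (supp s ''w'') (vec s ''cluster'') (vec s' ''cluster'')"
    unfolding grow_step_def eq using True by blast
  with True eq show ?thesis by auto
next
  case False
  then have "s' = s"
    using run s x y
    by (auto simp: propagate_step_def holds_instance_def vec_def supp_def split: if_splits)
  with False show ?thesis by auto
qed

text \<open>Positive labels never change, so a point labelled at the start of the round still offers
  its label whenever one of its edges is scanned.\<close>

lemma propagate_round_correct:
  assumes s: "holds_instance s" and run: "run propagate_round s s'"
  shows "(grow_step (supp s ''w''))\<^sup>*\<^sup>* (vec s ''cluster'') (vec s' ''cluster'') \<and>
    (\<forall>x\<in>supp s ''w''. \<forall>y\<in>supp s ''w''. (x, y) \<in> parcs G \<longrightarrow> 0 < vec s ''cluster'' x \<longrightarrow>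
      0 < vec s' ''cluster'' y)"
proof -
  let ?W = "supp s ''w''" and ?f = "vec s ''cluster''"
  let ?done = "\<lambda>x y s1. x \<in> ?W \<longrightarrow> y \<in> ?W \<longrightarrow> (x, y) \<in> parcs G \<longrightarrow> 0 < ?f x \<longrightarrow>
    0 < vec s1 ''cluster'' y"
  let ?I = "\<lambda>i s1. (grow_step ?W)\<^sup>*\<^sup>* ?f (vec s1 ''cluster'') \<and> (\<forall>x<i. \<forall>y<n. ?done x y s1)"
  have "?I n s' \<and> unchanged (insert ''x'' (nwrites (For ''y'' propagate_step)))
      (rwrites (For ''y'' propagate_step)) s s'"
  proof (rule run_For[where I = ?I])
    show "run (For ''x'' (For ''y'' propagate_step)) s s'"
      using run by (simp add: propagate_round_def)
  next
    fix i s1 s2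
    assume i: "i < n" "nmem s1 (''x'', 0, 0) = i" and run1: "run (For ''y'' propagate_step) s1 s2"
      and u1: "unchanged (insert ''x'' (nwrites (For ''y'' propagate_step)))
        (rwrites (For ''y'' propagate_step)) s s1" and I1: "?I i s1"
    have s1: "holds_instance s1" using holds_instance_unchanged[OF s u1] by simp
    let ?J = "\<lambda>j s2. (grow_step ?W)\<^sup>*\<^sup>* (vec s1 ''cluster'') (vec s2 ''cluster'') \<and>
      (\<forall>y<j. ?done i y s2)"
    have J: "?J n s2 \<and> unchanged (insert ''y'' (nwrites propagate_step))
        (rwrites propagate_step) s1 s2"
    proof (rule run_For[where I = ?J, OF run1])
      fix j t1 t2
      assume j: "j < n" "nmem t1 (''y'', 0, 0) = j" and run2: "run propagate_step t1 t2"
        and u2: "unchanged (insert ''y'' (nwrites propagate_step)) (rwrites propagate_step) s1 t1"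
        and J1: "?J j t1"
      have t1: "holds_instance t1" using holds_instance_unchanged[OF s1 u2] by simp
      have W: "supp t1 ''w'' = ?W"
        using supp_unchanged[OF u1] supp_unchanged[OF u2] by simp
      have x: "nmem t1 (''x'', 0, 0) = i" using unchangedD(1)[OF u2] i by simp
      have *: "(grow_step ?W)\<^sup>*\<^sup>* (vec t1 ''cluster'') (vec t2 ''cluster'')"
        "i \<in> ?W \<longrightarrow> j \<in> ?W \<longrightarrow> (i, j) \<in> parcs G \<longrightarrow> 0 < vec t1 ''cluster'' i \<longrightarrow>
          0 < vec t2 ''cluster'' j"
        using propagate_step_correct[OF t1 run2 x i(1) j(2,1)] unfolding W by auto
      have f: "(grow_step ?W)\<^sup>*\<^sup>* ?f (vec t1 ''cluster'')" using I1 J1 by auto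
      have "?done i y t2" if "y < Suc j" for y
      proof (cases "y = j")
        case True
        then show ?thesis using * grow_keeps[OF f, of i] by auto
      next
        case False
        then have "?done i y t1" using J1 that by auto
        then show ?thesis using grow_keeps[OF *(1), of y] by auto
      qed
      then show "?J (Suc j) t2" using J1 *(1) by auto
    qed (use s1 in \<open>auto simp: holds_instance_def\<close>)
    have "?done x y s2" if "x < Suc i" "y < n" for x y
    proof (cases "x = i")
      case True
      then show ?thesis using J that by auto
    next
      case False
      then have "x < i" using that by simp
      then have "?done x y s1" using I1 that by blast
      then show ?thesis using grow_keeps[of ?W "vec s1 ''cluster''" "vec s2 ''cluster''" y] J by auto
    qed
    then show "?I (Suc i) s2" using I1 J by auto
  qed (use s in \<open>auto simp: holds_instance_def\<close>)
  then show ?thesis using supp_less(1) by blast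
qed

text \<open>A round that labels no new point leaves the labels saturated; hence \<open>n\<close> rounds suffice.\<close>

lemma propagate_correct:
  assumes s: "holds_instance s" and run: "run propagate s s'"
  shows "saturates (supp s ''w'') (vec s ''cluster'') (vec s' ''cluster'')"
proof -
  let ?W = "supp s ''w''" and ?f = "vec s ''cluster''"
  let ?I = "\<lambda>i s1. (grow_step ?W)\<^sup>*\<^sup>* ?f (vec s1 ''cluster'') \<and>
    (saturated ?W (vec s1 ''cluster'') \<or> i \<le> card (supp s1 ''cluster''))"
  have "?I n s' \<and> unchanged (insert ''round'' (nwrites propagate_round))
      (rwrites propagate_round) s s'"
  proof (rule run_For[where I = ?I])
    show "run (For ''round'' propagate_round) s s'"
      using run by (simp add: propagate_def)
  next
    fix i s1 s2
    assume run1: "run propagate_round s1 s2"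
      and u1: "unchanged (insert ''round'' (nwrites propagate_round))
        (rwrites propagate_round) s s1" and I1: "?I i s1"
    have s1: "holds_instance s1" using holds_instance_unchanged[OF s u1] by simp
    have W: "supp s1 ''w'' = ?W" using supp_unchanged[OF u1] by simp
    have g: "(grow_step ?W)\<^sup>*\<^sup>* (vec s1 ''cluster'') (vec s2 ''cluster'')"
      and r: "\<And>x y. x \<in> ?W \<Longrightarrow> y \<in> ?W \<Longrightarrow> (x, y) \<in> parcs G \<Longrightarrow> 0 < vec s1 ''cluster'' x \<Longrightarrow>
        0 < vec s2 ''cluster'' y"
      using propagate_round_correct[OF s1 run1] unfolding W by auto
    have sub: "supp s1 ''cluster'' \<subseteq> supp s2 ''cluster''"
      using grow_keeps[OF g] by (auto simp flip: vec_pos_iff)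
    have "saturated ?W (vec s2 ''cluster'') \<or> Suc i \<le> card (supp s2 ''cluster'')"
    proof (cases "supp s1 ''cluster'' = supp s2 ''cluster''")
      case True
      then show ?thesis using r unfolding saturated_def vec_pos_iff by blast
    next
      case False
      then have less: "card (supp s1 ''cluster'') < card (supp s2 ''cluster'')"
        using sub supp_less by (meson psubsetI psubset_card_mono)
      \<comment> \<open>Saturated labels admit no growth step. A round that labels a new point
        therefore started unsaturated, where the invariant counts the labelled points.\<close>
      have "saturated ?W (vec s1 ''cluster'') \<Longrightarrow> False"
      proof -
        assume sat: "saturated ?W (vec s1 ''cluster'')"
        obtain x where x: "x \<in> supp s2 ''cluster''" "x \<notin> supp s1 ''cluster''" using False sub by auto
        have "(grow_step ?W)\<^sup>*\<^sup>* (vec s1 ''cluster'') h \<Longrightarrow> h = vec s1 ''cluster''" for h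
        proof (induction rule: rtranclp_induct)
          case (step g h)
          then have "grow_step ?W (vec s1 ''cluster'') h" by simp
          then show ?case using sat unfolding grow_step_def saturated_def by (metis less_irrefl)
        qed simp
        then have "vec s2 ''cluster'' = vec s1 ''cluster''" using g by blast
        then show False using x by (metis vec_pos_iff)
      qed
      then show ?thesis using I1 less by auto
    qed
    then show "?I (Suc i) s2" using I1 g by auto
  qed (use s in \<open>auto simp: holds_instance_def\<close>)
  then have g: "(grow_step ?W)\<^sup>*\<^sup>* ?f (vec s' ''cluster'')"
    and "saturated ?W (vec s' ''cluster'') \<or> n \<le> card (supp s' ''cluster'')" by auto
  moreover have "saturated ?W (vec s' ''cluster'')" if "n \<le> card (supp s' ''cluster'')"
  proof -
    have "supp s' ''cluster'' = {..<n}"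
      using supp_less[of s' "''cluster''"] that by (intro card_seteq) auto
    then show ?thesis using supp_less(1)[of s] by (auto simp: saturated_def vec_pos_iff)
  qed
  ultimately show ?thesis by (auto simp: saturates_def)
qed

end

section \<open>Choosing the centers\<close>

definition load_ball :: com where
  "load_ball = For ''x'' (Seq (set_entry ''cluster'' (Scalar ''x'') (NConst 0))
     (If (RLess (RScalar ''rho'') (Dist ''v'' ''x''))
       (set_entry ''w'' (Scalar ''x'') (NConst 0))
       (set_entry ''w'' (Scalar ''x'') (NConst 1))))"

definition mark_covered :: com where
  "mark_covered = For ''x'' (If (positive (Entry ''cluster'' (Scalar ''x'')))
     (set_entry ''cov'' (Scalar ''x'') (NConst 1)) Skip)"

text \<open>The array \<open>cluster\<close> serves as scratch space for one component here;
  \<open>singletons\<close> later overwrites it with the actual labels.\<close>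

definition cover_component :: com where
  "cover_component =
     Seq load_ball
    (Seq (set_entry ''cluster'' (Scalar ''v'') (NConst 1))
    (Seq propagate mark_covered))"

text \<open>The numbering in \<open>idx\<close> starts at 1, so a positive entry marks a chosen
  point and can later serve as its cluster index.\<close>

definition cover_all :: com where
  "cover_all = For ''v'' (If (positive (Entry ''cov'' (Scalar ''v''))) Skip
     (Seq (set_scalar ''m'' (NAdd (Scalar ''m'') (NConst 1)))
     (Seq (set_entry ''idx'' (Scalar ''v'') (Scalar ''m''))
       cover_component)))"

definition reset_covered :: com where
  "reset_covered = For ''v'' (Seq (set_entry ''cov'' (Scalar ''v'') (NConst 0))
     (set_entry ''idx'' (Scalar ''v'') (NConst 0)))"

definition greedy :: com where
  "greedy = Seq (set_scalar ''m'' (NConst 0)) (Seq reset_covered cover_all)"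

text \<open>The initial value 0 of \<open>best\<close> is no tested candidate; the flag
  \<open>found\<close> tells when \<open>best\<close> is meaningful.\<close>

definition search_step :: com where
  "search_step =
     Seq (set_rscalar ''rho'' (Dist ''i'' ''j''))
    (Seq greedy
      (If (BAnd (BNot (NLess (Scalar ''k'') (Scalar ''m'')))
            (BNot (BAnd (positive (Scalar ''found''))
              (BNot (RLess (RScalar ''rho'') (RScalar ''best''))))))
        (Seq (set_rscalar ''best'' (RScalar ''rho'')) (set_scalar ''found'' (NConst 1)))
        Skip))"

text \<open>All pairwise distances are tried, so success of the greedy choice need not be monotone
  in the radius.\<close>

definition search :: com where
  "search = For ''i'' (For ''j'' search_step)"

text \<open>The greedy choice may take fewer than \<open>k\<close> points, but a solution has
  exactly \<open>k\<close> clusters. Additional centers do no harm to the cover.\<close>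

definition fill_up :: com where
  "fill_up = For ''v''
     (If (BAnd (BNot (positive (Entry ''idx'' (Scalar ''v'')))) (NLess (Scalar ''m'') (Scalar ''k'')))
       (Seq (set_scalar ''m'' (NAdd (Scalar ''m'') (NConst 1)))
         (set_entry ''idx'' (Scalar ''v'') (Scalar ''m'')))
       Skip)"

text \<open>Points with \<open>idx\<close> 0 write to entry 0 of \<open>center\<close>, which
  belongs to no cluster.\<close>

definition singletons :: com where
  "singletons = For ''v''
     (Seq (set_entry ''cluster'' (Scalar ''v'') (Entry ''idx'' (Scalar ''v'')))
     (Seq (set_entry ''alive'' (Scalar ''v'') (Entry ''idx'' (Scalar ''v'')))
       (set_entry ''center'' (Entry ''idx'' (Scalar ''v'')) (Scalar ''v''))))"

lemma writes_greedy [simp]: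
  "nwrites load_ball = {''x'', ''cluster'', ''w''}" "rwrites load_ball = {}"
  "nwrites mark_covered = {''x'', ''cov''}" "rwrites mark_covered = {}"
  "nwrites cover_component = {''x'', ''y'', ''round'', ''cluster'', ''w'', ''cov''}"
  "rwrites cover_component = {}"
  "nwrites cover_all = {''v'', ''m'', ''idx'', ''x'', ''y'', ''round'', ''cluster'', ''w'', ''cov''}"
  "rwrites cover_all = {}"
  "nwrites reset_covered = {''v'', ''cov'', ''idx''}" "rwrites reset_covered = {}"
  "nwrites greedy = {''v'', ''m'', ''idx'', ''x'', ''y'', ''round'', ''cluster'', ''w'', ''cov''}"
  "rwrites greedy = {}"
  "nwrites search_step =
    {''v'', ''m'', ''idx'', ''x'', ''y'', ''round'', ''cluster'', ''w'', ''cov'', ''found''}"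
  "rwrites search_step = {''rho'', ''best''}"
  "nwrites search =
    {''i'', ''j'', ''v'', ''m'', ''idx'', ''x'', ''y'', ''round'', ''cluster'', ''w'', ''cov'', ''found''}"
  "rwrites search = {''rho'', ''best''}"
  "nwrites fill_up = {''v'', ''m'', ''idx''}" "rwrites fill_up = {}"
  "nwrites singletons = {''v'', ''cluster'', ''alive'', ''center''}" "rwrites singletons = {}"
  unfolding load_ball_def mark_covered_def cover_component_def cover_all_def reset_covered_def
    greedy_def search_step_def search_def fill_up_def singletons_def by auto

lemma bij_betw_insert_Suc:
  assumes "bij_betw f S {1..m}" "x \<notin> S"
  shows "bij_betw (f(x := Suc m)) (insert x S) {1..Suc m}"
proof -
  have "bij_betw (f(x := Suc m)) S {1..m}"
    using assms by (subst bij_betw_cong[of S _ f]) auto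
  moreover have "bij_betw (f(x := Suc m)) {x} {Suc m}" by simp
  ultimately have "bij_betw (f(x := Suc m)) (S \<union> {x}) ({1..m} \<union> {Suc m})"
    by (rule bij_betw_combine) simp
  moreover have "{1..m} \<union> {Suc m} = {1..Suc m}" by auto
  ultimately show ?thesis by simp
qed

context clustering
begin

section \<open>Correctness of the greedy choice and of the search\<close>

lemma load_ball_correct:
  assumes s: "holds_instance s" and run: "run load_ball s s'"
    and v: "nmem s (''v'', 0, 0) = v" "v < n"
  shows "supp s' ''w'' = ball v (rmem s (''rho'', 0, 0)) \<and> vec s' ''cluster'' = (\<lambda>x. 0)"
proof -
  let ?c = "Seq (set_entry ''cluster'' (Scalar ''x'') (NConst 0))
     (If (RLess (RScalar ''rho'') (Dist ''v'' ''x''))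
       (set_entry ''w'' (Scalar ''x'') (NConst 0))
       (set_entry ''w'' (Scalar ''x'') (NConst 1)))"
  let ?I = "\<lambda>i s1. (\<forall>x<i. x < n \<longrightarrow> vec s1 ''cluster'' x = 0 \<and>
    (x \<in> supp s1 ''w'' \<longleftrightarrow> d v x \<le> rmem s (''rho'', 0, 0)))"
  have "?I n s' \<and> unchanged (insert ''x'' (nwrites ?c)) (rwrites ?c) s s'"
  proof (rule run_For[where I = ?I])
    show "run (For ''x'' ?c) s s'" using run by (simp add: load_ball_def)
  next
    fix i s1 s2
    assume i: "i < n" "nmem s1 (''x'', 0, 0) = i" and run1: "run ?c s1 s2"
      and u: "unchanged (insert ''x'' (nwrites ?c)) (rwrites ?c) s s1" and I1: "?I i s1"
    have "rmem s1 (''dist'', v, i) = d v i"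
      using holds_instance_unchanged[OF s u] v(2) i(1) by (simp add: holds_instance_def)
    moreover have "nmem s1 (''v'', 0, 0) = v" "rmem s1 (''rho'', 0, 0) = rmem s (''rho'', 0, 0)"
      using unchangedD[OF u] v by auto
    ultimately show "?I (Suc i) s2"
      using run1 i I1 by (simp add: less_Suc_eq split: if_splits)
  qed (use s in \<open>auto simp: holds_instance_def\<close>)
  then have "\<And>x. x < n \<Longrightarrow> vec s' ''cluster'' x = 0 \<and>
    (x \<in> supp s' ''w'' \<longleftrightarrow> d v x \<le> rmem s (''rho'', 0, 0))" by blast
  moreover have "\<And>x. \<not> x < n \<Longrightarrow> vec s' ''cluster'' x = 0" by (simp add: vec_def)
  ultimately show ?thesis using supp_less(1)[of s' "''w''"] by blast
qed

lemma mark_covered_correct: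
  assumes s: "holds_instance s" and run: "run mark_covered s s'"
  shows "supp s' ''cov'' = supp s ''cov'' \<union> supp s ''cluster''"
proof -
  let ?c = "If (positive (Entry ''cluster'' (Scalar ''x'')))
     (set_entry ''cov'' (Scalar ''x'') (NConst 1)) Skip"
  let ?I = "\<lambda>i s1. supp s1 ''cov'' = supp s ''cov'' \<union> {x \<in> supp s ''cluster''. x < i}"
  have "?I n s' \<and> unchanged (insert ''x'' (nwrites ?c)) (rwrites ?c) s s'"
  proof (rule run_For[where I = ?I])
    show "run (For ''x'' ?c) s s'" using run by (simp add: mark_covered_def)
  next
    fix i s1 s2
    assume i: "i < n" "nmem s1 (''x'', 0, 0) = i" and run1: "run ?c s1 s2"
      and u: "unchanged (insert ''x'' (nwrites ?c)) (rwrites ?c) s s1" and I1: "?I i s1"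
    have "0 < nmem s1 (''cluster'', i, 0) \<longleftrightarrow> i \<in> supp s ''cluster''"
      using unchangedD(1)[OF u] i by (simp add: supp_def)
    then show "?I (Suc i) s2"
      using run1 i I1 by (auto simp: less_Suc_eq split: if_splits)
  qed (use s in \<open>auto simp: holds_instance_def\<close>)
  then show ?thesis using supp_less(1) by blast
qed

lemma cover_component_correct:
  assumes s: "holds_instance s" and run: "run cover_component s s'"
    and v: "nmem s (''v'', 0, 0) = v" "v < n" and rho: "0 \<le> rmem s (''rho'', 0, 0)"
  shows "supp s' ''cov'' = supp s ''cov'' \<union> comp (rmem s (''rho'', 0, 0)) v"
proof -
  from run obtain s1 s2 s3 where r1: "run load_ball s s1"
    and r2: "run (set_entry ''cluster'' (Scalar ''v'') (NConst 1)) s1 s2"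
    and r3: "run propagate s2 s3" and r4: "run mark_covered s3 s'"
    by (auto simp: cover_component_def)
  note u = run_unchanged[OF r1] run_unchanged[OF r2] run_unchanged[OF r3] run_unchanged[OF r4]
  have s1: "holds_instance s1" using holds_instance_unchanged[OF s u(1)] by simp
  have s2: "holds_instance s2" using holds_instance_unchanged[OF s1 u(2)] by simp
  have s3: "holds_instance s3" using holds_instance_unchanged[OF s2 u(3)] by simp
  note b = load_ball_correct[OF s r1 v]
  have "nmem s1 (''v'', 0, 0) = v" using unchangedD(1)[OF u(1)] v by simp
  then have "vec s2 ''cluster'' = (\<lambda>x. if x = v then 1 else 0)" "supp s2 ''w'' = supp s1 ''w''"
    using r2 v b by (auto simp: fun_eq_iff)
  then have "saturates (ball v (rmem s (''rho'', 0, 0))) (\<lambda>x. if x = v then 1 else 0)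
      (vec s3 ''cluster'')"
    using propagate_correct[OF s2 r3] b by simp
  then have "{x. 0 < vec s3 ''cluster'' x} = comp (rmem s (''rho'', 0, 0)) v"
    using v(2) rho by (rule saturates_comp)
  then have "supp s3 ''cluster'' = comp (rmem s (''rho'', 0, 0)) v"
    by (auto simp: vec_pos_iff)
  then show ?thesis
    using mark_covered_correct[OF s3 r4] supp_unchanged[OF u(1), of "''cov''"]
      supp_unchanged[OF u(2), of "''cov''"] supp_unchanged[OF u(3), of "''cov''"] by simp
qed

lemma reset_covered_correct:
  assumes s: "holds_instance s" and run: "run reset_covered s s'"
  shows "supp s' ''cov'' = {} \<and> supp s' ''idx'' = {}"
proof -
  let ?c = "Seq (set_entry ''cov'' (Scalar ''v'') (NConst 0))
     (set_entry ''idx'' (Scalar ''v'') (NConst 0))"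
  let ?I = "\<lambda>i s1. \<forall>x<i. x \<notin> supp s1 ''cov'' \<and> x \<notin> supp s1 ''idx''"
  have "?I n s' \<and> unchanged (insert ''v'' (nwrites ?c)) (rwrites ?c) s s'"
  proof (rule run_For[where I = ?I])
    show "run (For ''v'' ?c) s s'" using run by (simp add: reset_covered_def)
  next
    fix i s1 s2
    assume "i < n" "nmem s1 (''v'', 0, 0) = i" "run ?c s1 s2" "?I i s1"
    then show "?I (Suc i) s2" by (auto simp: less_Suc_eq)
  qed (use s in \<open>auto simp: holds_instance_def\<close>)
  then show ?thesis using supp_less(1) by blast
qed

lemma cover_all_correct:
  assumes s: "holds_instance s" and run: "run cover_all s s'"
    and rho: "rho = rmem s (''rho'', 0, 0)" "0 \<le> rho"
    and init: "nmem s (''m'', 0, 0) = 0" "supp s ''cov'' = {}" "supp s ''idx'' = {}"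
  shows "nmem s' (''m'', 0, 0) = card (greedy_set rho n) \<and> supp s' ''idx'' = greedy_set rho n \<and>
    bij_betw (vec s' ''idx'') (greedy_set rho n) {1..card (greedy_set rho n)}"
proof -
  let ?c = "If (positive (Entry ''cov'' (Scalar ''v''))) Skip
     (Seq (set_scalar ''m'' (NAdd (Scalar ''m'') (NConst 1)))
     (Seq (set_entry ''idx'' (Scalar ''v'') (Scalar ''m''))
       cover_component))"
  \<comment> \<open>The program follows the recursion of \<open>greedy_set\<close> point by point,
    with \<open>cov\<close> as the union of the components chosen so far.\<close>
  let ?I = "\<lambda>i s1. nmem s1 (''m'', 0, 0) = card (greedy_set rho i) \<and>
    supp s1 ''cov'' = \<Union> (comp rho ` greedy_set rho i) \<and> supp s1 ''idx'' = greedy_set rho i \<and>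
    bij_betw (vec s1 ''idx'') (greedy_set rho i) {1..card (greedy_set rho i)}"
  have "?I n s' \<and> unchanged (insert ''v'' (nwrites ?c)) (rwrites ?c) s s'"
  proof (rule run_For[where I = ?I])
    show "run (For ''v'' ?c) s s'" using run by (simp add: cover_all_def)
  next
    fix i s1 s2
    assume i: "i < n" "nmem s1 (''v'', 0, 0) = i" and run1: "run ?c s1 s2"
      and u: "unchanged (insert ''v'' (nwrites ?c)) (rwrites ?c) s s1" and I1: "?I i s1"
    have s1: "holds_instance s1" using holds_instance_unchanged[OF s u] by simp
    have rho1: "rmem s1 (''rho'', 0, 0) = rho" using unchangedD(2)[OF u] rho by simp
    show "?I (Suc i) s2"
    proof (cases "i \<in> supp s1 ''cov''")
      case True
      then have "s2 = s1" using run1 i by (simp add: supp_def)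
      with True I1 show ?thesis by simp
    next
      case False
      let ?m = "Suc (card (greedy_set rho i))"
      let ?t = "s1\<lparr>nmem := (nmem s1)((''m'', 0, 0) := ?m, (''idx'', i, 0) := ?m)\<rparr>"
      have r: "run cover_component ?t s2"
        using run1 False i I1 by (auto simp: supp_def)
      have t: "holds_instance ?t" using s1 by (simp add: holds_instance_def)
      have "supp s2 ''cov'' = supp ?t ''cov'' \<union> comp (rmem ?t (''rho'', 0, 0)) i"
        using i rho rho1 by (intro cover_component_correct[OF t r]) auto
      moreover have "supp ?t ''cov'' = supp s1 ''cov''" by (simp add: supp_def)
      ultimately have cov: "supp s2 ''cov'' = supp s1 ''cov'' \<union> comp rho i" using rho1 by simp
      have "vec s2 ''idx'' = vec ?t ''idx''" "supp s2 ''idx'' = supp ?t ''idx''"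
        using vec_unchanged[OF run_unchanged[OF r]] supp_unchanged[OF run_unchanged[OF r]] by auto
      moreover have "vec ?t ''idx'' = (vec s1 ''idx'')(i := ?m)"
        "supp ?t ''idx'' = insert i (supp s1 ''idx'')"
        using i by (auto simp: vec_def supp_def)
      moreover have "nmem s2 (''m'', 0, 0) = ?m"
        using unchangedD(1)[OF run_unchanged[OF r], of "''m''"] by simp
      moreover have ni: "i \<notin> greedy_set rho i" using greedy_set_subset by blast
      moreover have "greedy_set rho (Suc i) = insert i (greedy_set rho i)"
        using False I1 by simp
      ultimately show ?thesis
        using I1 cov bij_betw_insert_Suc[of "vec s1 ''idx''" "greedy_set rho i" _ i] by auto
    qed
  qed (use s init in \<open>auto simp: holds_instance_def bij_betw_def\<close>)
  then show ?thesis by blast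
qed

lemma greedy_correct:
  assumes s: "holds_instance s" and run: "run greedy s s'"
    and rho: "rho = rmem s (''rho'', 0, 0)" "0 \<le> rho"
  shows "nmem s' (''m'', 0, 0) = card (greedy_set rho n) \<and> supp s' ''idx'' = greedy_set rho n \<and>
    bij_betw (vec s' ''idx'') (greedy_set rho n) {1..card (greedy_set rho n)}"
proof -
  from run obtain s1 s2 where r1: "run (set_scalar ''m'' (NConst 0)) s s1"
    and r2: "run reset_covered s1 s2" and r3: "run cover_all s2 s'"
    by (auto simp: greedy_def)
  note u = run_unchanged[OF r1] run_unchanged[OF r2]
  have s1: "holds_instance s1" using holds_instance_unchanged[OF s u(1)] by simp
  have s2: "holds_instance s2" using holds_instance_unchanged[OF s1 u(2)] by simp
  show ?thesis
    using reset_covered_correct[OF s1 r2] r1 rho unchangedD[OF u(2)]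
    by (intro cover_all_correct[OF s2 r3]) auto
qed

text \<open>\<open>P\<close> contains the pairs tried so far. The first half will bound
  \<open>best\<close> by the diameter of any solution; the second guarantees that at most
  \<open>k\<close> centers cover all points with radius \<open>best\<close>.\<close>

definition search_inv :: "(nat \<times> nat) set \<Rightarrow> state \<Rightarrow> bool" where
  "search_inv P s \<longleftrightarrow>
     (\<forall>(i, j)\<in>P. card (greedy_set (d i j) n) \<le> k \<longrightarrow>
       0 < nmem s (''found'', 0, 0) \<and> rmem s (''best'', 0, 0) \<le> d i j) \<and>
     (0 < nmem s (''found'', 0, 0) \<longrightarrow>
       0 \<le> rmem s (''best'', 0, 0) \<and> card (greedy_set (rmem s (''best'', 0, 0)) n) \<le> k)"

lemma search_step_correct:
  assumes s: "holds_instance s" and run: "run search_step s s'"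
    and i: "nmem s (''i'', 0, 0) = i" "i < n" and j: "nmem s (''j'', 0, 0) = j" "j < n"
    and inv: "search_inv P s"
  shows "search_inv (insert (i, j) P) s'"
proof -
  let ?s1 = "s\<lparr>rmem := (rmem s)((''rho'', 0, 0) := d i j)\<rparr>"
  let ?b = "BAnd (BNot (NLess (Scalar ''k'') (Scalar ''m'')))
    (BNot (BAnd (positive (Scalar ''found'')) (BNot (RLess (RScalar ''rho'') (RScalar ''best'')))))"
  from run obtain s2 where r1: "run greedy ?s1 s2"
    and r2: "run (If ?b (Seq (set_rscalar ''best'' (RScalar ''rho'')) (set_scalar ''found'' (NConst 1)))
      Skip) s2 s'"
    using s i j by (simp add: search_step_def holds_instance_def) blast
  have s1: "holds_instance ?s1" using s by (simp add: holds_instance_def)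
  have m: "nmem s2 (''m'', 0, 0) = card (greedy_set (d i j) n)"
    using greedy_correct[OF s1 r1, of "d i j"] d_nonneg by simp
  note u = unchangedD[OF run_unchanged[OF r1]]
  have s2: "nmem s2 (''found'', 0, 0) = nmem s (''found'', 0, 0)"
    "nmem s2 (''k'', 0, 0) = k"
    "rmem s2 (''best'', 0, 0) = rmem s (''best'', 0, 0)" "rmem s2 (''rho'', 0, 0) = d i j"
    using u s by (auto simp: holds_instance_def)
  show ?thesis
  proof (cases "bval ?b s2")
    case True
    then have "nmem s' (''found'', 0, 0) = 1" "rmem s' (''best'', 0, 0) = d i j"
      using r2 s2 by auto
    moreover have "card (greedy_set (d i j) n) \<le> k"
      "0 < nmem s (''found'', 0, 0) \<longrightarrow> d i j < rmem s (''best'', 0, 0)"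
      using True m s2 by auto
    ultimately show ?thesis
      using inv d_nonneg unfolding search_inv_def by fastforce
  next
    case False
    then have "s' = s2" using r2 by auto
    with False show ?thesis using inv m s2 unfolding search_inv_def by auto
  qed
qed

lemma search_correct:
  assumes s: "holds_instance s" and run: "run search s s'"
    and init: "nmem s (''found'', 0, 0) = 0"
  shows "search_inv ({..<n} \<times> {..<n}) s'"
proof -
  let ?c = "For ''j'' search_step"
  have "search_inv ({..<n} \<times> {..<n}) s' \<and> unchanged (insert ''i'' (nwrites ?c)) (rwrites ?c) s s'"
  proof (rule run_For[where I = "\<lambda>i. search_inv ({..<i} \<times> {..<n})"])
    show "run (For ''i'' ?c) s s'" using run by (simp add: search_def)
  next
    fix i s1 s2
    assume i: "i < n" "nmem s1 (''i'', 0, 0) = i" and run1: "run ?c s1 s2"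
      and u: "unchanged (insert ''i'' (nwrites ?c)) (rwrites ?c) s s1"
      and I: "search_inv ({..<i} \<times> {..<n}) s1"
    have s1: "holds_instance s1" using holds_instance_unchanged[OF s u] by simp
    have "search_inv ({..<i} \<times> {..<n} \<union> {i} \<times> {..<n}) s2 \<and>
      unchanged (insert ''j'' (nwrites search_step)) (rwrites search_step) s1 s2"
    proof (rule run_For[where I = "\<lambda>j. search_inv ({..<i} \<times> {..<n} \<union> {i} \<times> {..<j})", OF run1])
      fix j t1 t2
      assume j: "j < n" "nmem t1 (''j'', 0, 0) = j" and run2: "run search_step t1 t2"
        and u1: "unchanged (insert ''j'' (nwrites search_step)) (rwrites search_step) s1 t1"
        and J: "search_inv ({..<i} \<times> {..<n} \<union> {i} \<times> {..<j}) t1"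
      have t1: "holds_instance t1" using holds_instance_unchanged[OF s1 u1] by simp
      have "search_inv (insert (i, j) ({..<i} \<times> {..<n} \<union> {i} \<times> {..<j})) t2"
        using unchangedD(1)[OF u1, of "''i''"] i j
        by (intro search_step_correct[OF t1 run2 _ _ _ _ J]) auto
      moreover have "insert (i, j) ({..<i} \<times> {..<n} \<union> {i} \<times> {..<j}) =
        {..<i} \<times> {..<n} \<union> {i} \<times> {..<Suc j}" by auto
      ultimately show "search_inv ({..<i} \<times> {..<n} \<union> {i} \<times> {..<Suc j}) t2" by simp
    qed (use s1 I in \<open>auto simp: holds_instance_def search_inv_def\<close>)
    moreover have "{..<i} \<times> {..<n} \<union> {i} \<times> {..<n} = {..<Suc i} \<times> {..<n}" by auto
    ultimately show "search_inv ({..<Suc i} \<times> {..<n}) s2" by simp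
  qed (use s init in \<open>auto simp: holds_instance_def search_inv_def\<close>)
  then show ?thesis by blast
qed

section \<open>Starting with exactly \<open>k\<close> singleton clusters\<close>

lemma fill_up_correct:
  assumes s: "holds_instance s" and run: "run fill_up s s'" and kn: "k \<le> n"
    and init: "nmem s (''m'', 0, 0) \<le> k" "bij_betw (vec s ''idx'') (supp s ''idx'') {1..nmem s (''m'', 0, 0)}"
  shows "supp s ''idx'' \<subseteq> supp s' ''idx'' \<and> bij_betw (vec s' ''idx'') (supp s' ''idx'') {1..k}"
proof -
  let ?c = "If (BAnd (BNot (positive (Entry ''idx'' (Scalar ''v'')))) (NLess (Scalar ''m'') (Scalar ''k'')))
       (Seq (set_scalar ''m'' (NAdd (Scalar ''m'') (NConst 1)))
         (set_entry ''idx'' (Scalar ''v'') (Scalar ''m'')))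
       Skip"
  let ?I = "\<lambda>i s1. supp s ''idx'' \<subseteq> supp s1 ''idx'' \<and> nmem s1 (''m'', 0, 0) \<le> k \<and>
    bij_betw (vec s1 ''idx'') (supp s1 ''idx'') {1..nmem s1 (''m'', 0, 0)} \<and>
    (nmem s1 (''m'', 0, 0) = k \<or> {..<i} \<subseteq> supp s1 ''idx'')"
  have "?I n s' \<and> unchanged (insert ''v'' (nwrites ?c)) (rwrites ?c) s s'"
  proof (rule run_For[where I = ?I])
    show "run (For ''v'' ?c) s s'" using run by (simp add: fill_up_def)
  next
    fix i s1 s2
    assume i: "i < n" "nmem s1 (''v'', 0, 0) = i" and run1: "run ?c s1 s2"
      and u: "unchanged (insert ''v'' (nwrites ?c)) (rwrites ?c) s s1" and I1: "?I i s1"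
    have k1: "nmem s1 (''k'', 0, 0) = k"
      using holds_instance_unchanged[OF s u] by (simp add: holds_instance_def)
    let ?m = "nmem s1 (''m'', 0, 0)"
    show "?I (Suc i) s2"
    proof (cases "i \<notin> supp s1 ''idx'' \<and> ?m < k")
      case False
      then have "s2 = s1" using run1 i k1 by (auto simp: supp_def split: if_splits)
      with False I1 show ?thesis by (auto simp: lessThan_Suc)
    next
      case True
      then have s2: "s2 = s1\<lparr>nmem := (nmem s1)((''m'', 0, 0) := Suc ?m, (''idx'', i, 0) := Suc ?m)\<rparr>"
        using run1 i k1 by (auto simp: supp_def)
      have "vec s2 ''idx'' = (vec s1 ''idx'')(i := Suc ?m)"
        "supp s2 ''idx'' = insert i (supp s1 ''idx'')" "nmem s2 (''m'', 0, 0) = Suc ?m"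
        unfolding s2 using i by (auto simp: vec_def supp_def)
      then show ?thesis
        using I1 True bij_betw_insert_Suc[of "vec s1 ''idx''" "supp s1 ''idx''" ?m i]
        by (auto simp: lessThan_Suc)
    qed
  qed (use s init in \<open>auto simp: holds_instance_def\<close>)
  \<comment> \<open>If the numbering never stopped at \<open>k\<close>, all \<open>n\<close> points
    are numbered, so the counter is \<open>n\<close> and hence at least \<open>k\<close>.\<close>
  moreover have "nmem s' (''m'', 0, 0) = k" if "?I n s'"
  proof (rule disjE[OF conjunct2[OF conjunct2[OF conjunct2[OF that]]]])
    assume "{..<n} \<subseteq> supp s' ''idx''"
    then have "n \<le> card (supp s' ''idx'')" using supp_less(2) by (metis card_lessThan card_mono)
    moreover have "card (supp s' ''idx'') = nmem s' (''m'', 0, 0)"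
      using that bij_betw_same_card by fastforce
    ultimately show ?thesis using that kn by simp
  qed
  ultimately show ?thesis by auto
qed

lemma singletons_correct:
  assumes s: "holds_instance s" and run: "run singletons s s'"
    and bij: "bij_betw (vec s ''idx'') (supp s ''idx'') {1..k}"
  shows "supp s' ''cluster'' = supp s ''idx'' \<and> supp s' ''alive'' = supp s ''idx'' \<and>
    clustered (\<lambda>i. nmem s' (''center'', i, 0)) (vec s' ''cluster'') 0"
proof -
  let ?c = "Seq (set_entry ''cluster'' (Scalar ''v'') (Entry ''idx'' (Scalar ''v'')))
     (Seq (set_entry ''alive'' (Scalar ''v'') (Entry ''idx'' (Scalar ''v'')))
       (set_entry ''center'' (Entry ''idx'' (Scalar ''v'')) (Scalar ''v'')))"
  let ?h = "vec s ''idx''"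
  let ?I = "\<lambda>i s1. \<forall>x<i. x < n \<longrightarrow> vec s1 ''cluster'' x = ?h x \<and> vec s1 ''alive'' x = ?h x \<and>
    (0 < ?h x \<longrightarrow> nmem s1 (''center'', ?h x, 0) = x)"
  have inj: "x = y" if "?h x = ?h y" "0 < ?h x" for x y
    using inj_onD[OF bij_betw_imp_inj_on[OF bij], of x y] that by (simp flip: vec_pos_iff)
  have I: "?I n s' \<and> unchanged (insert ''v'' (nwrites ?c)) (rwrites ?c) s s'"
  proof (rule run_For[where I = ?I])
    show "run (For ''v'' ?c) s s'" using run by (simp add: singletons_def)
  next
    fix i s1 s2
    assume i: "i < n" "nmem s1 (''v'', 0, 0) = i" and run1: "run ?c s1 s2"
      and u: "unchanged (insert ''v'' (nwrites ?c)) (rwrites ?c) s s1" and I1: "?I i s1"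
    have h: "nmem s1 (''idx'', i, 0) = ?h i"
      using unchangedD(1)[OF u] i by (simp add: vec_def)
    have s2: "s2 = s1\<lparr>nmem := (nmem s1)((''cluster'', i, 0) := ?h i,
      (''alive'', i, 0) := ?h i, (''center'', ?h i, 0) := i)\<rparr>"
      using run1 i h by simp
    have "vec s2 ''cluster'' = (vec s1 ''cluster'')(i := ?h i)"
      "vec s2 ''alive'' = (vec s1 ''alive'')(i := ?h i)"
      unfolding s2 using i by (auto simp: vec_def)
    moreover have "nmem s2 (''center'', l, 0) = (if l = ?h i then i else nmem s1 (''center'', l, 0))" for l
      unfolding s2 by simp
    \<comment> \<open>Positive indices are distinct, so the \<open>center\<close> entry of an
      earlier center is not overwritten.\<close>
    moreover have "?h x \<noteq> ?h i" if "x < i" "0 < ?h x" for x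
      using inj[of x i] that by auto
    ultimately show "?I (Suc i) s2"
      using I1 by (simp add: less_Suc_eq)
  qed (use s in \<open>auto simp: holds_instance_def\<close>)
  then have cl: "vec s' ''cluster'' = ?h" and al: "vec s' ''alive'' = ?h"
    and z: "\<And>x. x < n \<Longrightarrow> 0 < ?h x \<Longrightarrow> nmem s' (''center'', ?h x, 0) = x"
    by (auto simp: fun_eq_iff vec_def)
  have supp: "supp s' ''cluster'' = supp s ''idx''" "supp s' ''alive'' = supp s ''idx''"
    using cl al by (auto simp flip: vec_pos_iff)
  have h: "?h x \<in> {1..k}" if "0 < ?h x" for x
    using bij_betw_apply[OF bij, of x] that vec_pos_iff[of s "''idx''" x] by blast
  have "nmem s' (''center'', i, 0) < n \<and> ?h (nmem s' (''center'', i, 0)) = i \<and> linked (part ?h i)"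
    if i: "i \<in> {1..k}" for i
  proof -
    have "i \<in> ?h ` supp s ''idx''" using bij i by (simp only: bij_betw_def)
    then obtain x where x: "x \<in> supp s ''idx''" "?h x = i" by blast
    then have xn: "x < n" using supp_less(1) by blast
    have "0 < ?h x" using x vec_pos_iff by blast
    then have "part ?h i = {x}" using x xn inj by auto
    then show ?thesis using z[OF xn] x xn \<open>0 < ?h x\<close> by (auto simp: linked_def)
  qed
  moreover have "?h x \<le> k \<and> d x (nmem s' (''center'', ?h x, 0)) \<le> 0" if "x < n" "0 < ?h x" for x
    using z[OF that] h[OF that(2)] d_refl that by simp
  ultimately show ?thesis using supp unfolding clustered_def cl by blast
qed

end

section \<open>Decomposition into layers of separated groups\<close>

definition count :: "bexp \<Rightarrow> string \<Rightarrow> com" where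
  "count c a = For ''u'' (If c (set_scalar a (NAdd (Scalar a) (NConst 1))) Skip)"

text \<open>This is the outer radius \<open>R + r + r\<close> of
  \<open>layer_inv_group\<close>.\<close>

definition wide :: rexp where
  "wide = RAdd (RAdd (RScalar ''rad'') (RScalar ''rho'')) (RScalar ''rho'')"

definition near :: "rexp \<Rightarrow> bexp" where
  "near e = BAnd (positive (Entry ''act'' (Scalar ''u''))) (BNot (RLess e (Dist ''v'' ''u'')))"

definition radius_step :: com where
  "radius_step =
     Seq (set_scalar ''a'' (NConst 0)) (Seq (set_scalar ''b'' (NConst 0))
    (Seq (count (near (RScalar ''rad'')) ''a'') (Seq (count (near wide) ''b'')
      (If (NLess (NAdd (Scalar ''a'') (Scalar ''a'')) (Scalar ''b''))
        (set_rscalar ''rad'' wide) Skip))))"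

definition find_radius :: com where
  "find_radius = Seq (set_rscalar ''rad'' RZero) (For ''round'' radius_step)"

definition clear_region :: com where
  "clear_region = For ''x'' (set_entry ''w'' (Scalar ''x'') (NConst 0))"

definition add_ball :: com where
  "add_ball = For ''x'' (If (RLess (RScalar ''rho'') (Dist ''u'' ''x'')) Skip
     (set_entry ''w'' (Scalar ''x'') (NConst 1)))"

definition collect_group :: com where
  "collect_group = For ''u'' (If (near (RScalar ''rad''))
     (Seq (set_entry ''alive'' (Scalar ''u'') (NConst 0)) add_ball) Skip)"

text \<open>The group itself is deactivated along with its shell. The shell stays marked in
  \<open>alive\<close> and therefore returns in the next layer.\<close>

definition postpone :: com where
  "postpone = For ''u'' (If (RLess wide (Dist ''v'' ''u'')) Skip
     (set_entry ''act'' (Scalar ''u'') (NConst 0)))"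

definition group_step :: com where
  "group_step = Seq find_radius (Seq clear_region (Seq collect_group (Seq postpone propagate)))"

text \<open>In terms of \<open>layer_inv\<close>, the array \<open>alive\<close> holds
  \<open>al\<close> and \<open>act\<close> holds \<open>ac\<close>; a layer begins with nothing
  postponed.\<close>

definition activate :: com where
  "activate = For ''v'' (set_entry ''act'' (Scalar ''v'') (Entry ''alive'' (Scalar ''v'')))"

definition group_all :: com where
  "group_all = For ''v'' (If (positive (Entry ''act'' (Scalar ''v''))) group_step Skip)"

definition decompose :: com where
  "decompose = For ''layer'' (Seq activate group_all)"

definition algorithm :: com where
  "algorithm = Seq search (If (positive (Scalar ''found''))
     (Seq (set_rscalar ''rho'' (RScalar ''best'')) (Seq greedy
       (Seq fill_up (Seq singletons decompose)))) Skip)"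

lemma writes_decompose [simp]:
  "nwrites (count c a) = {''u'', a}" "rwrites (count c a) = {}"
  "nwrites radius_step = {''u'', ''a'', ''b''}" "rwrites radius_step = {''rad''}"
  "nwrites find_radius = {''round'', ''u'', ''a'', ''b''}" "rwrites find_radius = {''rad''}"
  "nwrites clear_region = {''x'', ''w''}" "rwrites clear_region = {}"
  "nwrites add_ball = {''x'', ''w''}" "rwrites add_ball = {}"
  "nwrites collect_group = {''u'', ''x'', ''w'', ''alive''}" "rwrites collect_group = {}"
  "nwrites postpone = {''u'', ''act''}" "rwrites postpone = {}"
  "nwrites group_step =
    {''u'', ''x'', ''y'', ''a'', ''b'', ''w'', ''alive'', ''act'', ''round'', ''cluster''}"
  "rwrites group_step = {''rad''}"
  "nwrites activate = {''v'', ''act''}" "rwrites activate = {}"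
  "nwrites group_all =
    {''v'', ''u'', ''x'', ''y'', ''a'', ''b'', ''w'', ''alive'', ''act'', ''round'', ''cluster''}"
  "rwrites group_all = {''rad''}"
  "nwrites decompose =
    {''layer'', ''v'', ''u'', ''x'', ''y'', ''a'', ''b'', ''w'', ''alive'', ''act'', ''round'', ''cluster''}"
  "rwrites decompose = {''rad''}"
  unfolding count_def radius_step_def find_radius_def clear_region_def add_ball_def
    collect_group_def postpone_def group_step_def activate_def group_all_def decompose_def by auto

section \<open>Running time of the algorithm\<close>

lemma polytime_algorithm: "polytime algorithm"
  unfolding algorithm_def search_def search_step_def greedy_def reset_covered_def cover_all_def
    cover_component_def load_ball_def mark_covered_def fill_up_def singletons_def decompose_def
    group_all_def activate_def group_step_def find_radius_def radius_step_def count_def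
    clear_region_def collect_group_def add_ball_def postpone_def
    propagate_def propagate_round_def propagate_step_def
  by (intro polytime_intros) simp_all

lemma polynomial_time_algorithm: "polynomial_time algorithm"
proof -
  obtain p :: "nat poly" where
    "\<And>s. \<exists>t s'. exec algorithm s t s' \<and> t \<le> poly p (nmem s (''n'', 0, 0))"
    using polytime_algorithm unfolding polytime_def by metis
  moreover have "nmem (input n G d k) (''n'', 0, 0) = n" for n G d k by (simp add: input_def)
  ultimately show ?thesis unfolding polynomial_time_def by metis
qed

context clustering
begin

section \<open>Correctness of forming a group\<close>

lemma count_correct:
  assumes s: "holds_instance s" and run: "run (count c a) s s'" and a: "a \<noteq> ''u''" "a \<noteq> ''n''"
    and P: "\<And>i s1. i < n \<Longrightarrow> nmem s1 (''u'', 0, 0) = i \<Longrightarrow> unchanged {''u'', a} {} s s1 \<Longrightarrow>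
      bval c s1 \<longleftrightarrow> P i"
  shows "nmem s' (a, 0, 0) = nmem s (a, 0, 0) + card {i. i < n \<and> P i}"
proof -
  let ?c = "If c (set_scalar a (NAdd (Scalar a) (NConst 1))) Skip"
  let ?I = "\<lambda>i s1. nmem s1 (a, 0, 0) = nmem s (a, 0, 0) + card {j. j < i \<and> P j}"
  have "?I n s' \<and> unchanged (insert ''u'' (nwrites ?c)) (rwrites ?c) s s'"
  proof (rule run_For[where I = ?I])
    show "run (For ''u'' ?c) s s'" using run by (simp add: count_def)
  next
    fix i s1 s2
    assume i: "i < n" "nmem s1 (''u'', 0, 0) = i" and run1: "run ?c s1 s2"
      and u: "unchanged (insert ''u'' (nwrites ?c)) (rwrites ?c) s s1" and I1: "?I i s1"
    have c: "bval c s1 \<longleftrightarrow> P i" using P[OF i] u by simp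
    have "{j. j < Suc i \<and> P j} = (if P i then insert i {j. j < i \<and> P j} else {j. j < i \<and> P j})"
      by (auto simp: less_Suc_eq)
    then show "?I (Suc i) s2" using run1 I1 c by (auto split: if_splits)
  qed (use s a in \<open>auto simp: holds_instance_def\<close>)
  then show ?thesis by blast
qed

abbreviation act_ball :: "state \<Rightarrow> nat \<Rightarrow> real \<Rightarrow> nat set" where
  "act_ball s v r \<equiv> {u \<in> supp s ''act''. d v u \<le> r}"

lemma near_iff:
  assumes s: "holds_instance s1" and v: "nmem s1 (''v'', 0, 0) = v" "v < n"
    and u: "nmem s1 (''u'', 0, 0) = u" "u < n"
  shows "bval (near e) s1 \<longleftrightarrow> u \<in> act_ball s1 v (rval e s1)"
  using assms by (auto simp: near_def holds_instance_def supp_def)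

lemma radius_step_correct:
  assumes s: "holds_instance s" and run: "run radius_step s s'"
    and v: "nmem s (''v'', 0, 0) = v" "v < n"
    and R: "R = rmem s (''rad'', 0, 0)" and R': "R' = R + rmem s (''rho'', 0, 0) + rmem s (''rho'', 0, 0)"
  shows "rmem s' (''rad'', 0, 0) =
    (if 2 * card (act_ball s v R) < card (act_ball s v R') then R' else R)"
proof -
  from run obtain s1 s2 s3 where
    s1: "s1 = s\<lparr>nmem := (nmem s)((''a'', 0, 0) := 0, (''b'', 0, 0) := 0)\<rparr>"
    and r1: "run (count (near (RScalar ''rad'')) ''a'') s1 s2"
    and r2: "run (count (near wide) ''b'') s2 s3"
    and r3: "run (If (NLess (NAdd (Scalar ''a'') (Scalar ''a'')) (Scalar ''b''))
        (set_rscalar ''rad'' wide) Skip) s3 s'"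
    unfolding radius_step_def by auto
  have u1: "unchanged {''a'', ''b''} {} s s1" unfolding s1 unchanged_def by auto
  note u2 = run_unchanged[OF r1, simplified] and u3 = run_unchanged[OF r2, simplified]
  have h1: "holds_instance s1" using holds_instance_unchanged[OF s u1] by simp
  have h2: "holds_instance s2" using holds_instance_unchanged[OF h1 u2] by simp
  have "nmem s2 (''a'', 0, 0) = nmem s1 (''a'', 0, 0) +
      card {i. i < n \<and> i \<in> act_ball s v R}"
  proof (rule count_correct[OF h1 r1])
    fix i t assume i: "i < n" "nmem t (''u'', 0, 0) = i" and u: "unchanged {''u'', ''a''} {} s1 t"
    have "holds_instance t" using holds_instance_unchanged[OF h1 u] by simp
    moreover have "nmem t (''v'', 0, 0) = v" "rmem t (''rad'', 0, 0) = R"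
      using unchangedD[OF u] unchangedD[OF u1] v R by simp_all
    moreover have "supp t ''act'' = supp s ''act''"
      using supp_unchanged[OF u] supp_unchanged[OF u1] by simp
    ultimately show "bval (near (RScalar ''rad'')) t \<longleftrightarrow> i \<in> act_ball s v R"
      using near_iff[of t v i "RScalar ''rad''"] v i by simp
  qed simp_all
  moreover have "nmem s3 (''b'', 0, 0) = nmem s2 (''b'', 0, 0) +
      card {i. i < n \<and> i \<in> act_ball s v R'}"
  proof (rule count_correct[OF h2 r2])
    fix i t assume i: "i < n" "nmem t (''u'', 0, 0) = i" and u: "unchanged {''u'', ''b''} {} s2 t"
    have "holds_instance t" using holds_instance_unchanged[OF h2 u] by simp
    moreover have "nmem t (''v'', 0, 0) = v" "rval wide t = R'"
      using unchangedD[OF u] unchangedD[OF u1] unchangedD[OF u2] v R R' by (simp_all add: wide_def)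
    moreover have "supp t ''act'' = supp s ''act''"
      using supp_unchanged[OF u] supp_unchanged[OF u1] supp_unchanged[OF u2] by simp
    ultimately show "bval (near wide) t \<longleftrightarrow> i \<in> act_ball s v R'"
      using near_iff[of t v i wide] v i by simp
  qed simp_all
  moreover have "{i. i < n \<and> i \<in> act_ball s v r} = act_ball s v r" for r
    using supp_less(1) by blast
  ultimately have "nmem s3 (''a'', 0, 0) = card (act_ball s v R)"
      "nmem s3 (''b'', 0, 0) = card (act_ball s v R')"
    using unchangedD(1)[OF u2, of "''b''"] unchangedD(1)[OF u3, of "''a''"] s1 by simp_all
  moreover have "rval wide s3 = R'" "rmem s3 (''rad'', 0, 0) = R"
    using unchangedD[OF u1] unchangedD[OF u2] unchangedD[OF u3] R R' by (simp_all add: wide_def)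
  ultimately show ?thesis using r3 by (auto split: if_splits)
qed

text \<open>As long as the radius grows, the ball doubles, so it stops growing within \<open>n\<close> rounds.\<close>

lemma find_radius_correct:
  assumes s: "holds_instance s" and run: "run find_radius s s'"
    and v: "nmem s (''v'', 0, 0) = v" "v \<in> supp s ''act''"
    and rho: "rho = rmem s (''rho'', 0, 0)"
  obtains j where "rmem s' (''rad'', 0, 0) = real j * (2 * rho)"
    "2 ^ j \<le> card (act_ball s v (real j * (2 * rho)))"
    "card (act_ball s v (real j * (2 * rho) + rho + rho)) \<le> 2 * card (act_ball s v (real j * (2 * rho)))"
proof -
  have vn: "v < n" using v supp_less(1) by blast
  let ?R = "\<lambda>j. real j * (2 * rho)"
  let ?stable = "\<lambda>j. card (act_ball s v (?R j + rho + rho)) \<le> 2 * card (act_ball s v (?R j))"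
  \<comment> \<open>Either every round so far has enlarged the radius, so that \<open>j\<close> is
    the number of rounds, or the radius is final. The power of 2 starts with \<open>v\<close> itself
    as the only guaranteed member of the ball.\<close>
  let ?I = "\<lambda>i s1. \<exists>j. rmem s1 (''rad'', 0, 0) = ?R j \<and> 2 ^ j \<le> card (act_ball s v (?R j)) \<and>
    (j = i \<or> ?stable j)"
  let ?s0 = "s\<lparr>rmem := (rmem s)((''rad'', 0, 0) := 0)\<rparr>"
  have "v \<in> act_ball s v 0" using v vn d_refl by simp
  then have "0 < card (act_ball s v 0)" using supp_less(2)[of s "''act''"] by (auto simp: card_gt_0_iff)
  then have init: "?I 0 ?s0" by (intro exI[of _ 0]) auto
  have u0: "unchanged {} {''rad''} s ?s0" by (auto simp: unchanged_def)
  have h0: "holds_instance ?s0" using holds_instance_unchanged[OF s u0] by simp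
  have "?I n s' \<and> unchanged (insert ''round'' (nwrites radius_step)) (rwrites radius_step) ?s0 s'"
  proof (rule run_For[where I = ?I])
    show "run (For ''round'' radius_step) ?s0 s'" using run by (simp add: find_radius_def)
  next
    fix i s1 s2
    assume run1: "run radius_step s1 s2" and I1: "?I i s1"
      and u: "unchanged (insert ''round'' (nwrites radius_step)) (rwrites radius_step) ?s0 s1"
    have h: "holds_instance s1" using holds_instance_unchanged[OF h0 u] by simp
    have v1: "nmem s1 (''v'', 0, 0) = v" and rho1: "rmem s1 (''rho'', 0, 0) = rho"
      using unchangedD[OF u] v rho by simp_all
    have act: "supp s1 ''act'' = supp s ''act''" using supp_unchanged[OF u] by simp
    obtain j where j: "rmem s1 (''rad'', 0, 0) = ?R j" "2 ^ j \<le> card (act_ball s v (?R j))"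
      "j = i \<or> ?stable j" using I1 by blast
    have *: "rmem s2 (''rad'', 0, 0) = (if ?stable j then ?R j else ?R j + rho + rho)"
      using radius_step_correct[OF h run1 v1 vn refl refl] j(1) act rho1 by auto
    show "?I (Suc i) s2"
    proof (cases "?stable j")
      case True
      then show ?thesis using * j by auto
    next
      case False
      moreover have "?R j + rho + rho = ?R (Suc j)" by (simp add: algebra_simps)
      ultimately show ?thesis using * j by (intro exI[of _ "Suc j"]) auto
    qed
  qed (use h0 init in \<open>auto simp: holds_instance_def\<close>)
  then obtain j where j: "rmem s' (''rad'', 0, 0) = ?R j" "2 ^ j \<le> card (act_ball s v (?R j))"
      "j = n \<or> ?stable j" by blast
  have "card (act_ball s v (?R j)) \<le> card {..<n}"
    using supp_less(1)[of s "''act''"] by (intro card_mono) auto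
  then have "2 ^ j \<le> n" using j(2) by simp
  \<comment> \<open>Since \<open>2 ^ n > n\<close>, the radius cannot have grown in all
    \<open>n\<close> rounds.\<close>
  then have "j \<noteq> n" using less_exp[of n] by (metis not_le)
  with j that show ?thesis by blast
qed

lemma clear_region_correct:
  assumes s: "holds_instance s" and run: "run clear_region s s'"
  shows "supp s' ''w'' = {}"
proof -
  let ?c = "set_entry ''w'' (Scalar ''x'') (NConst 0)"
  let ?I = "\<lambda>i s1. \<forall>x<i. x \<notin> supp s1 ''w''"
  have "?I n s' \<and> unchanged (insert ''x'' (nwrites ?c)) (rwrites ?c) s s'"
  proof (rule run_For[where I = ?I])
    show "run (For ''x'' ?c) s s'" using run by (simp add: clear_region_def)
  qed (use s in \<open>auto simp: holds_instance_def less_Suc_eq\<close>)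
  then show ?thesis using supp_less(1) by blast
qed

lemma add_ball_correct:
  assumes s: "holds_instance s" and run: "run add_ball s s'"
    and u: "nmem s (''u'', 0, 0) = u" "u < n"
  shows "supp s' ''w'' = supp s ''w'' \<union> ball u (rmem s (''rho'', 0, 0))"
proof -
  let ?c = "If (RLess (RScalar ''rho'') (Dist ''u'' ''x'')) Skip
     (set_entry ''w'' (Scalar ''x'') (NConst 1))"
  let ?I = "\<lambda>i s1. supp s1 ''w'' = supp s ''w'' \<union> {x. x < i \<and> d u x \<le> rmem s (''rho'', 0, 0)}"
  have "?I n s' \<and> unchanged (insert ''x'' (nwrites ?c)) (rwrites ?c) s s'"
  proof (rule run_For[where I = ?I])
    show "run (For ''x'' ?c) s s'" using run by (simp add: add_ball_def)
  next
    fix i s1 s2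
    assume i: "i < n" "nmem s1 (''x'', 0, 0) = i" and run1: "run ?c s1 s2"
      and uc: "unchanged (insert ''x'' (nwrites ?c)) (rwrites ?c) s s1" and I1: "?I i s1"
    have "rmem s1 (''dist'', u, i) = d u i"
      using holds_instance_unchanged[OF s uc] u(2) i(1) by (simp add: holds_instance_def)
    moreover have "nmem s1 (''u'', 0, 0) = u" "rmem s1 (''rho'', 0, 0) = rmem s (''rho'', 0, 0)"
      using unchangedD[OF uc] u by auto
    ultimately have "supp s2 ''w'' =
        (if d u i \<le> rmem s (''rho'', 0, 0) then insert i (supp s1 ''w'') else supp s1 ''w'')"
      using run1 i by (cases "d u i \<le> rmem s (''rho'', 0, 0)") simp_all
    then show "?I (Suc i) s2" using I1 by (auto simp: less_Suc_eq)
  qed (use s in \<open>auto simp: holds_instance_def\<close>)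
  then show ?thesis by blast
qed

lemma collect_group_correct:
  assumes s: "holds_instance s" and run: "run collect_group s s'"
    and v: "nmem s (''v'', 0, 0) = v" "v < n"
    and w: "supp s ''w'' = {}" and B: "B = act_ball s v (rmem s (''rad'', 0, 0))"
  shows "supp s' ''w'' = {x. x < n \<and> (\<exists>u\<in>B. d u x \<le> rmem s (''rho'', 0, 0))} \<and>
    supp s' ''alive'' = supp s ''alive'' - B"
proof -
  let ?c = "If (near (RScalar ''rad''))
     (Seq (set_entry ''alive'' (Scalar ''u'') (NConst 0)) add_ball) Skip"
  let ?W = "\<lambda>i. {x. x < n \<and> (\<exists>u\<in>B. u < i \<and> d u x \<le> rmem s (''rho'', 0, 0))}"
  let ?I = "\<lambda>i s1. supp s1 ''w'' = ?W i \<and> supp s1 ''alive'' = supp s ''alive'' - {u \<in> B. u < i}"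
  have "?I n s' \<and> unchanged (insert ''u'' (nwrites ?c)) (rwrites ?c) s s'"
  proof (rule run_For[where I = ?I])
    show "run (For ''u'' ?c) s s'" using run by (simp add: collect_group_def)
  next
    fix i s1 s2
    assume i: "i < n" "nmem s1 (''u'', 0, 0) = i" and run1: "run ?c s1 s2"
      and uc: "unchanged (insert ''u'' (nwrites ?c)) (rwrites ?c) s s1" and I1: "?I i s1"
    have h: "holds_instance s1" using holds_instance_unchanged[OF s uc] by simp
    have v1: "nmem s1 (''v'', 0, 0) = v" and rm: "rmem s1 = rmem s"
      using unchangedD[OF uc] v by (auto simp: fun_eq_iff)
    have "bval (near (RScalar ''rad'')) s1 \<longleftrightarrow> i \<in> B"
      using near_iff[OF h v1 v(2) i(2,1), of "RScalar ''rad''"] rm supp_unchanged[OF uc, of "''act''"]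
      by (simp add: B)
    note b = this
    show "?I (Suc i) s2"
    proof (cases "i \<in> B")
      case False
      then have "s2 = s1" using b run1 by simp
      moreover have "?W (Suc i) = ?W i" "{u \<in> B. u < Suc i} = {u \<in> B. u < i}"
        using False by (auto simp: less_Suc_eq)
      ultimately show ?thesis using I1 by simp
    next
      case True
      let ?t = "s1\<lparr>nmem := (nmem s1)((''alive'', i, 0) := 0)\<rparr>"
      have r: "run add_ball ?t s2" using True b run1 i by simp
      have t: "holds_instance ?t" using h by (simp add: holds_instance_def)
      have "supp s2 ''w'' = supp ?t ''w'' \<union> ball i (rmem ?t (''rho'', 0, 0))"
        using i by (intro add_ball_correct[OF t r]) auto
      then have "supp s2 ''w'' = ?W i \<union> ball i (rmem s (''rho'', 0, 0))"
        using I1 rm by simp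
      moreover have "?W (Suc i) = ?W i \<union> ball i (rmem s (''rho'', 0, 0))"
        using True by (auto simp: less_Suc_eq)
      moreover have "supp s2 ''alive'' = supp s1 ''alive'' - {i}"
        using supp_unchanged[OF run_unchanged[OF r], of "''alive''"] i by simp
      moreover have "{u \<in> B. u < Suc i} = insert i {u \<in> B. u < i}"
        using True by (auto simp: less_Suc_eq)
      ultimately show ?thesis using I1 by auto
    qed
  qed (use s w in \<open>auto simp: holds_instance_def\<close>)
  moreover have "u < n" if "u \<in> B" for u using that B supp_less(1) by blast
  ultimately show ?thesis by auto
qed

lemma postpone_correct:
  assumes s: "holds_instance s" and run: "run postpone s s'"
    and v: "nmem s (''v'', 0, 0) = v" "v < n"
  shows "supp s' ''act'' = supp s ''act'' - act_ball s v (rval wide s)"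
proof -
  let ?c = "If (RLess wide (Dist ''v'' ''u'')) Skip
     (set_entry ''act'' (Scalar ''u'') (NConst 0))"
  let ?I = "\<lambda>i s1. supp s1 ''act'' = supp s ''act'' - {u. u < i \<and> d v u \<le> rval wide s}"
  have "?I n s' \<and> unchanged (insert ''u'' (nwrites ?c)) (rwrites ?c) s s'"
  proof (rule run_For[where I = ?I])
    show "run (For ''u'' ?c) s s'" using run by (simp add: postpone_def)
  next
    fix i s1 s2
    assume i: "i < n" "nmem s1 (''u'', 0, 0) = i" and run1: "run ?c s1 s2"
      and uc: "unchanged (insert ''u'' (nwrites ?c)) (rwrites ?c) s s1" and I1: "?I i s1"
    have "rmem s1 (''dist'', v, i) = d v i"
      using holds_instance_unchanged[OF s uc] v(2) i(1) by (simp add: holds_instance_def)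
    moreover have "nmem s1 (''v'', 0, 0) = v" "rval wide s1 = rval wide s"
      using unchangedD[OF uc] v by (auto simp: wide_def)
    ultimately have "supp s2 ''act'' =
        (if d v i \<le> rval wide s then supp s1 ''act'' - {i} else supp s1 ''act'')"
      using run1 i by (cases "d v i \<le> rval wide s") simp_all
    then show "?I (Suc i) s2" using I1 by (auto simp: less_Suc_eq)
  qed (use s in \<open>auto simp: holds_instance_def wide_def\<close>)
  then show ?thesis using supp_less(1)[of s] by auto
qed

text \<open>This bounds the diameter \<open>2 * (R + r)\<close> of a group's region, where
  \<open>R = 2 * r * j\<close> and \<open>j\<close> is at most the binary logarithm of
  \<open>k\<close>. It is the price of one layer.\<close>

definition growth :: "real \<Rightarrow> real" where
  "growth r = r * (4 * log 2 (real k) + 2)"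

lemma group_step_correct:
  assumes s: "holds_instance s" and run: "run group_step s s'"
    and v: "nmem s (''v'', 0, 0) = v" "v \<in> supp s ''act''"
    and rho: "rho = rmem s (''rho'', 0, 0)" "0 \<le> rho"
    and S: "S \<subseteq> {..<n}" "card S \<le> k" and f0: "clustered z f0 b0"
    and inv: "layer_inv rho S z (b0 + growth rho) f0 A0
      (vec s ''cluster'') (supp s ''alive'') (supp s ''act'')"
  shows "layer_inv rho S z (b0 + growth rho) f0 A0
      (vec s' ''cluster'') (supp s' ''alive'') (supp s' ''act'') \<and>
    supp s' ''act'' \<subseteq> supp s ''act'' - {v}"
proof -
  have vn: "v < n" using v supp_less(1) by blast
  from run obtain s1 s2 s3 s4 where r1: "run find_radius s s1" and r2: "run clear_region s1 s2"
    and r3: "run collect_group s2 s3" and r4: "run postpone s3 s4" and r5: "run propagate s4 s'"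
    unfolding group_step_def by auto
  note u = run_unchanged[OF r1, simplified] run_unchanged[OF r2, simplified]
    run_unchanged[OF r3, simplified] run_unchanged[OF r4, simplified] run_unchanged[OF r5, simplified]
  have h1: "holds_instance s1" using holds_instance_unchanged[OF s u(1)] by simp
  have h2: "holds_instance s2" using holds_instance_unchanged[OF h1 u(2)] by simp
  have h3: "holds_instance s3" using holds_instance_unchanged[OF h2 u(3)] by simp
  have h4: "holds_instance s4" using holds_instance_unchanged[OF h3 u(4)] by simp
  obtain j where j: "rmem s1 (''rad'', 0, 0) = real j * (2 * rho)"
    "2 ^ j \<le> card (act_ball s v (real j * (2 * rho)))"
    "card (act_ball s v (real j * (2 * rho) + rho + rho)) \<le> 2 * card (act_ball s v (real j * (2 * rho)))"
    using find_radius_correct[OF s r1 v rho(1)] .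
  define R where "R = real j * (2 * rho)"
  define B where "B = act_ball s v R"
  define B' where "B' = act_ball s v (R + rho + rho)"
  have v2: "nmem s2 (''v'', 0, 0) = v" and v3: "nmem s3 (''v'', 0, 0) = v"
    using v unchangedD(1)[OF u(1)] unchangedD(1)[OF u(2)] unchangedD(1)[OF u(3)] by simp_all
  have rm: "rmem s2 (''rad'', 0, 0) = R" "rmem s2 (''rho'', 0, 0) = rho" "rval wide s3 = R + rho + rho"
    using j(1) rho unchangedD(2)[OF u(1)] unchangedD(2)[OF u(2)] unchangedD(2)[OF u(3)]
    by (simp_all add: R_def wide_def)
  have act: "supp s2 ''act'' = supp s ''act''" "supp s3 ''act'' = supp s ''act''"
    using supp_unchanged[OF u(1)] supp_unchanged[OF u(2)] supp_unchanged[OF u(3)] by simp_all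
  have alive: "supp s2 ''alive'' = supp s ''alive''"
    using supp_unchanged[OF u(1)] supp_unchanged[OF u(2)] by simp
  have "B = act_ball s2 v (rmem s2 (''rad'', 0, 0))" using B_def rm act by simp
  note c = collect_group_correct[OF h2 r3 v2 vn clear_region_correct[OF h1 r2] this]
  have "supp s4 ''act'' = supp s3 ''act'' - act_ball s3 v (rval wide s3)"
    using postpone_correct[OF h3 r4 v3 vn] .
  then have act4: "supp s' ''act'' = supp s ''act'' - B'"
    using supp_unchanged[OF u(5), of "''act''"] rm act by (simp add: B'_def)
  have al4: "supp s' ''alive'' = supp s ''alive'' - B"
    using supp_unchanged[OF u(5), of "''alive''"] supp_unchanged[OF u(4), of "''alive''"] c alive by simp
  have W: "supp s4 ''w'' = {x. x < n \<and> (\<exists>u\<in>B. d u x \<le> rho)}"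
    using supp_unchanged[OF u(4), of "''w''"] c rm by simp
  have cl: "vec s4 ''cluster'' = vec s ''cluster''"
    using vec_unchanged[OF u(1)] vec_unchanged[OF u(2)] vec_unchanged[OF u(3)] vec_unchanged[OF u(4)]
    by simp
  have fin: "finite S" using S finite_subset by blast
  \<comment> \<open>The ball contains only centers, of which there are at most \<open>k\<close>;
    this turns the \<open>2 ^ j\<close> members into a logarithmic bound on
    \<open>j\<close>.\<close>
  have "B \<subseteq> S" using inv by (auto simp: layer_inv_def B_def)
  then have "2 ^ j \<le> k"
    using j(2) S card_mono[OF fin] unfolding B_def R_def by (meson le_trans)
  then have "(2::real) ^ j \<le> real k" by (metis of_nat_le_iff of_nat_numeral of_nat_power)
  then have "real j \<le> log 2 (real k)"
    using k_pos by (subst le_log_iff) (auto simp: powr_realpow)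
  then have "rho * (4 * real j + 2) \<le> growth rho"
    unfolding growth_def using rho by (intro mult_left_mono) auto
  then have b: "b0 + 2 * (R + rho) \<le> b0 + growth rho" by (simp add: R_def algebra_simps)
  have "saturates (supp s4 ''w'') (vec s ''cluster'') (vec s' ''cluster'')"
    using propagate_correct[OF h4 r5] cl by simp
  moreover have "card B' \<le> 2 * card B" using j(3) by (simp add: B_def B'_def R_def)
  ultimately have "layer_inv rho S z (b0 + growth rho) f0 A0 (vec s' ''cluster'')
      (supp s ''alive'' - B) (supp s ''act'' - B')"
    using layer_inv_group[OF inv S(1) f0 b v(2) B_def B'_def _ rho(2) W] by blast
  \<comment> \<open>The point \<open>v\<close> has distance 0 from itself, so the step deactivates
    it and the scan makes progress.\<close>
  moreover have "v \<in> B'" using v vn rho d_refl by (simp add: B'_def R_def)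
  ultimately show ?thesis using act4 al4 by auto
qed

section \<open>Layers and their number\<close>

definition covering_inv :: "real \<Rightarrow> nat set \<Rightarrow> (nat \<Rightarrow> nat) \<Rightarrow> real \<Rightarrow> state \<Rightarrow> bool" where
  "covering_inv r S z b s \<longleftrightarrow>
     clustered z (vec s ''cluster'') b \<and> supp s ''alive'' \<subseteq> S \<and> S \<subseteq> supp s ''cluster'' \<and>
     (\<forall>u\<in>S - supp s ''alive''. comp r u \<subseteq> supp s ''cluster'')"

lemma activate_correct:
  assumes s: "holds_instance s" and run: "run activate s s'"
  shows "supp s' ''act'' = supp s ''alive''"
proof -
  let ?c = "set_entry ''act'' (Scalar ''v'') (Entry ''alive'' (Scalar ''v''))"
  let ?I = "\<lambda>i s1. \<forall>x<i. x \<in> supp s1 ''act'' \<longleftrightarrow> x \<in> supp s ''alive''"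
  have "?I n s' \<and> unchanged (insert ''v'' (nwrites ?c)) (rwrites ?c) s s'"
  proof (rule run_For[where I = ?I])
    show "run (For ''v'' ?c) s s'" using run by (simp add: activate_def)
  next
    fix i s1 s2
    assume i: "i < n" "nmem s1 (''v'', 0, 0) = i" and run1: "run ?c s1 s2"
      and uc: "unchanged (insert ''v'' (nwrites ?c)) (rwrites ?c) s s1" and I1: "?I i s1"
    have "0 < nmem s1 (''alive'', i, 0) \<longleftrightarrow> i \<in> supp s ''alive''"
      using unchangedD(1)[OF uc] i by (simp add: supp_def)
    then show "?I (Suc i) s2" using run1 i I1 by (simp add: less_Suc_eq)
  qed (use s in \<open>auto simp: holds_instance_def\<close>)
  then show ?thesis using supp_less(1) by blast
qed

text \<open>The layer costs \<open>growth rho\<close> only once, because all its groups grow from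
  the labels at its beginning. The third conclusion covers idle layers, which must not increase the
  radius since \<open>n\<close> layers are always run.\<close>

lemma layer_correct:
  assumes s: "holds_instance s" and run: "run (Seq activate group_all) s s'"
    and rho: "rho = rmem s (''rho'', 0, 0)" "0 \<le> rho"
    and S: "S \<subseteq> {..<n}" "card S \<le> k" and inv: "covering_inv rho S z b s"
  shows "covering_inv rho S z (b + growth rho) s'"
    "2 * card (supp s' ''alive'') \<le> card (supp s ''alive'')"
    "supp s ''alive'' = {} \<Longrightarrow> covering_inv rho S z b s'"
proof -
  from run obtain s1 where r1: "run activate s s1" and r2: "run group_all s1 s'" by auto
  note u1 = run_unchanged[OF r1, simplified]
  have h1: "holds_instance s1" using holds_instance_unchanged[OF s u1] by simp
  have s1: "vec s1 ''cluster'' = vec s ''cluster''" "supp s1 ''cluster'' = supp s ''cluster''"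
    "supp s1 ''alive'' = supp s ''alive''"
    "supp s1 ''act'' = supp s ''alive''" "rmem s1 (''rho'', 0, 0) = rho"
    using vec_unchanged[OF u1] supp_unchanged[OF u1] activate_correct[OF s r1] unchangedD(2)[OF u1] rho
    by simp_all
  let ?f0 = "vec s ''cluster''" and ?A0 = "supp s ''alive''"
  have f0: "clustered z ?f0 b" using inv by (simp add: covering_inv_def)
  have "0 \<le> growth rho" using rho k_pos by (simp add: growth_def)
  then have f0': "clustered z ?f0 (b + growth rho)" using clustered_mono[OF f0] by simp
  let ?L = "\<lambda>t. layer_inv rho S z (b + growth rho) ?f0 ?A0
    (vec t ''cluster'') (supp t ''alive'') (supp t ''act'')"
  \<comment> \<open>The center visited by the scan is inactive afterwards, so active centers always
    lie ahead and none is left at the end.\<close>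
  let ?I = "\<lambda>i t. ?L t \<and> supp t ''act'' \<subseteq> {i..} \<and>
    (?A0 = {} \<longrightarrow> vec t ''cluster'' = ?f0 \<and> supp t ''alive'' = {} \<and> supp t ''act'' = {})"
  let ?c = "If (positive (Entry ''act'' (Scalar ''v''))) group_step Skip"
  have init: "?I 0 s1"
    using inv f0' s1 unfolding layer_inv_def covering_inv_def vec_pos_iff by auto
  have I: "?I n s' \<and> unchanged (insert ''v'' (nwrites ?c)) (rwrites ?c) s1 s'"
  proof (rule run_For[where I = ?I])
    show "run (For ''v'' ?c) s1 s'" using r2 by (simp add: group_all_def)
  next
    fix i t1 t2
    assume i: "i < n" "nmem t1 (''v'', 0, 0) = i" and run1: "run ?c t1 t2"
      and uc: "unchanged (insert ''v'' (nwrites ?c)) (rwrites ?c) s1 t1" and I1: "?I i t1"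
    have t1: "holds_instance t1" using holds_instance_unchanged[OF h1 uc] by simp
    have rho1: "rho = rmem t1 (''rho'', 0, 0)" using unchangedD(2)[OF uc] s1 by simp
    show "?I (Suc i) t2"
    proof (cases "i \<in> supp t1 ''act''")
      case False
      then have "t2 = t1" using run1 i by (simp add: supp_def)
      moreover have "supp t1 ''act'' \<subseteq> {Suc i..}"
        using I1 False by (force simp: Suc_le_eq less_le)
      ultimately show ?thesis using I1 by blast
    next
      case True
      then have r: "run group_step t1 t2" using run1 i by (simp add: supp_def)
      have L1: "?L t1" using I1 by blast
      have "?L t2" and sub: "supp t2 ''act'' \<subseteq> supp t1 ''act'' - {i}"
        using group_step_correct[OF t1 r i(2) True rho1 rho(2) S f0 L1] by auto
      moreover have "supp t2 ''act'' \<subseteq> {Suc i..}"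
        using I1 sub by (force simp: Suc_le_eq less_le)
      moreover have "?A0 \<noteq> {}" using True I1 by auto
      ultimately show ?thesis by blast
    qed
  qed (use h1 init in \<open>auto simp: holds_instance_def\<close>)
  then have act: "supp s' ''act'' = {}" using supp_less(1)[of s' "''act''"] by force
  have L: "?L s'" using I by blast
  then show inv': "covering_inv rho S z (b + growth rho) s'"
    unfolding layer_inv_def covering_inv_def by (auto simp: vec_pos_iff)
  \<comment> \<open>With no active center left, all ungrouped centers are postponed ones, and these
    are no more than the grouped ones.\<close>
  have "card (supp s' ''alive'') \<le> card (?A0 - supp s' ''alive'')" "supp s' ''alive'' \<subseteq> ?A0"
    using L act by (auto simp: layer_inv_def)
  then show "2 * card (supp s' ''alive'') \<le> card ?A0"
    using supp_less(2) card_Diff_subset[of "supp s' ''alive''" ?A0] card_mono[of ?A0 "supp s' ''alive''"]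
    by simp
  assume "?A0 = {}"
  then have "clustered z (vec s' ''cluster'') b" using I f0 by simp
  then show "covering_inv rho S z b s'" using inv' by (simp add: covering_inv_def)
qed

lemma decompose_correct:
  assumes s: "holds_instance s" and run: "run decompose s s'"
    and rho: "rho = rmem s (''rho'', 0, 0)" "0 \<le> rho"
    and S: "S \<subseteq> {..<n}" "card S \<le> k" and kn: "k \<le> n" and inv: "covering_inv rho S z 0 s"
  shows "covering_inv rho S z ((log 2 (real k) + 1) * growth rho) s' \<and> supp s' ''alive'' = {}"
proof -
  have growth: "0 \<le> growth rho" using rho k_pos by (simp add: growth_def)
  let ?c = "Seq activate group_all"
  \<comment> \<open>Here \<open>e\<close> counts the layers that began with an ungrouped center;
    only these increase the radius.\<close>
  let ?I = "\<lambda>i t. \<exists>e::nat. covering_inv rho S z (real e * growth rho) t \<and>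
    2 ^ e * card (supp t ''alive'') \<le> k \<and> real e \<le> log 2 (real k) + 1 \<and>
    (e = i \<or> supp t ''alive'' = {})"
  have "card (supp s ''alive'') \<le> k"
    using inv S card_mono[of S "supp s ''alive''"] finite_subset[OF S(1)]
    by (auto simp: covering_inv_def)
  then have init: "?I 0 s" using inv k_pos by (intro exI[of _ 0]) simp
  have "?I n s' \<and> unchanged (insert ''layer'' (nwrites ?c)) (rwrites ?c) s s'"
  proof (rule run_For[where I = ?I])
    show "run (For ''layer'' ?c) s s'" using run by (simp add: decompose_def)
  next
    fix i t m assume "?I i t" then show "?I i (put ''layer'' m t)"
      by (simp add: covering_inv_def)
  next
    fix i t1 t2
    assume run1: "run ?c t1 t2" and I1: "?I i t1"
      and uc: "unchanged (insert ''layer'' (nwrites ?c)) (rwrites ?c) s t1"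
    have t1: "holds_instance t1" using holds_instance_unchanged[OF s uc] by simp
    have rho1: "rho = rmem t1 (''rho'', 0, 0)" using unchangedD(2)[OF uc] rho by simp
    obtain e where e: "covering_inv rho S z (real e * growth rho) t1"
      "2 ^ e * card (supp t1 ''alive'') \<le> k" "real e \<le> log 2 (real k) + 1"
      "e = i \<or> supp t1 ''alive'' = {}" using I1 by blast
    note l = layer_correct[OF t1 run1 rho1 rho(2) S e(1)]
    show "?I (Suc i) t2"
    proof (cases "supp t1 ''alive'' = {}")
      case True
      then have "supp t2 ''alive'' = {}" using l(2) supp_less(2) by simp
      then show ?thesis using l(3)[OF True] e by (intro exI[of _ e]) simp
    next
      case False
      \<comment> \<open>A surviving center forces \<open>2 ^ e \<le> k\<close>, so \<open>e\<close>
        is at most the logarithm before this layer; the layer itself accounts for the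
        \<open>+ 1\<close>.\<close>
      then have "1 \<le> card (supp t1 ''alive'')" using supp_less(2) by (simp add: Suc_le_eq card_gt_0_iff)
      then have "2 ^ e * 1 \<le> 2 ^ e * card (supp t1 ''alive'')" by (intro mult_le_mono2)
      from le_trans[OF this e(2)] have "2 ^ e \<le> k" by simp
      then have "(2::real) ^ e \<le> real k" by (metis of_nat_le_iff of_nat_numeral of_nat_power)
      then have "real e \<le> log 2 (real k)"
        using k_pos by (subst le_log_iff) (auto simp: powr_realpow)
      moreover have "2 ^ Suc e * card (supp t2 ''alive'') \<le> k"
      proof -
        have "2 ^ Suc e * card (supp t2 ''alive'') = 2 ^ e * (2 * card (supp t2 ''alive''))" by simp
        also have "\<dots> \<le> 2 ^ e * card (supp t1 ''alive'')" using l(2) by (intro mult_le_mono2)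
        finally show ?thesis using e(2) by (rule le_trans)
      qed
      moreover have "covering_inv rho S z (real (Suc e) * growth rho) t2"
        using l(1) by (simp add: algebra_simps)
      ultimately show ?thesis using e(4) False by (intro exI[of _ "Suc e"]) auto
    qed
  qed (use s init in \<open>auto simp: holds_instance_def\<close>)
  then obtain e :: nat where e: "covering_inv rho S z (real e * growth rho) s'"
      "2 ^ e * card (supp s' ''alive'') \<le> k" "real e \<le> log 2 (real k) + 1"
      "e = n \<or> supp s' ''alive'' = {}" by blast
  \<comment> \<open>Otherwise all \<open>n\<close> layers halved a set that is still nonempty, which
    gives \<open>2 ^ n \<le> k \<le> n\<close>.\<close>
  have "supp s' ''alive'' = {}"
  proof (rule ccontr)
    assume ne: "supp s' ''alive'' \<noteq> {}"
    then have "2 ^ n * card (supp s' ''alive'') \<le> n" using e kn by auto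
    moreover have "1 \<le> card (supp s' ''alive'')" using ne supp_less(2) by (simp add: Suc_le_eq card_gt_0_iff)
    ultimately have "2 ^ n \<le> n" by (metis le_trans mult.right_neutral mult_le_mono2)
    then show False using less_exp[of n] by simp
  qed
  moreover have "real e * growth rho \<le> (log 2 (real k) + 1) * growth rho"
    using e(3) growth by (rule mult_right_mono)
  ultimately show ?thesis using e(1) clustered_mono by (auto simp: covering_inv_def)
qed

section \<open>Costs of feasible solutions\<close>

lemma connected_partition_k_le:
  assumes "connected_partition G k C"
  shows "k \<le> n"
proof -
  have "\<forall>i\<in>{1..k}. \<exists>x. x \<in> C i" using assms unfolding connected_partition_def by blast
  then obtain h where h: "\<And>i. i \<in> {1..k} \<Longrightarrow> h i \<in> C i" by metis
  have disj: "disjoint_family_on C {1..k}" and cover: "(\<Union>i\<in>{1..k}. C i) = {..<n}"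
    using assms pverts_eq by (simp_all add: connected_partition_def)
  have "inj_on h {1..k}"
  proof (rule inj_onI)
    fix i j assume ij: "i \<in> {1..k}" "j \<in> {1..k}" "h i = h j"
    then have "h i \<in> C i \<inter> C j" using h[OF ij(1)] h[OF ij(2)] by simp
    then show "i = j" using disjoint_family_onD[OF disj ij(1,2)] by blast
  qed
  moreover have "h ` {1..k} \<subseteq> {..<n}" using h cover by blast
  ultimately have "card {1..k} \<le> card {..<n}" by (rule card_inj_on_le) simp
  then show ?thesis by simp
qed

lemma connected_partition_finite:
  assumes "connected_partition G k C" "i \<in> {1..k}"
  shows "finite (C i)" "C i \<noteq> {}" "C i \<subseteq> {..<n}"
proof -
  show "C i \<noteq> {}" "C i \<subseteq> {..<n}"
    using assms pverts_eq by (auto simp: connected_partition_def)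
  then show "finite (C i)" using finite_subset by blast
qed

lemma diameter_cost_ge:
  assumes C: "connected_partition G k C" and i: "i \<in> {1..k}" "x \<in> C i" "y \<in> C i"
  shows "d x y \<le> diameter_cost d k C"
proof -
  note fin = connected_partition_finite[OF C]
  have "d x y \<le> (MAX y\<in>C i. d x y)" using fin i by (intro Max_ge) auto
  also have "\<dots> \<le> (MAX x\<in>C i. MAX y\<in>C i. d x y)" using fin i by (intro Max_ge) auto
  also have "\<dots> \<le> diameter_cost d k C"
    unfolding diameter_cost_def using i by (intro Max_ge) auto
  finally show ?thesis .
qed

text \<open>This makes the diameter of any solution one of the candidates that the search
  tries.\<close>

lemma diameter_cost_attained:
  assumes C: "connected_partition G k C"
  obtains x y where "x < n" "y < n" "diameter_cost d k C = d x y"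
proof -
  note fin = connected_partition_finite[OF C]
  have "diameter_cost d k C \<in> (\<lambda>i. MAX x\<in>C i. MAX y\<in>C i. d x y) ` {1..k}"
    unfolding diameter_cost_def using k_pos by (intro Max_in) auto
  then obtain i where i: "i \<in> {1..k}" "diameter_cost d k C = (MAX x\<in>C i. MAX y\<in>C i. d x y)" by blast
  have "(MAX x\<in>C i. MAX y\<in>C i. d x y) \<in> (\<lambda>x. MAX y\<in>C i. d x y) ` C i"
    using fin[OF i(1)] by (intro Max_in) auto
  then obtain x where x: "x \<in> C i" "diameter_cost d k C = (MAX y\<in>C i. d x y)" using i by auto
  have "(MAX y\<in>C i. d x y) \<in> d x ` C i" using fin[OF i(1)] by (intro Max_in) auto
  then obtain y where "y \<in> C i" "diameter_cost d k C = d x y" using x by auto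
  with x fin(3)[OF i(1)] that show ?thesis by blast
qed

lemma diameter_cost_le_center_cost:
  assumes C: "centered_partition G k C c"
  shows "diameter_cost d k C \<le> 2 * center_cost d k C c"
proof -
  have conn: "connected_partition G k C" using C by (simp add: centered_partition_def)
  note fin = connected_partition_finite[OF conn]
  have le: "d x (c i) \<le> center_cost d k C c" if "i \<in> {1..k}" "x \<in> C i" for i x
  proof -
    have "d x (c i) \<le> (MAX x\<in>C i. d x (c i))" using fin that by (intro Max_ge) auto
    also have "\<dots> \<le> center_cost d k C c"
      unfolding center_cost_def using that by (intro Max_ge) auto
    finally show ?thesis .
  qed
  have "d x y \<le> 2 * center_cost d k C c" if i: "i \<in> {1..k}" and xy: "x \<in> C i" "y \<in> C i" for i x y
  proof -
    have "c i \<in> C i" using C i by (simp add: centered_partition_def)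
    then have "d x y \<le> d x (c i) + d (c i) y"
      using fin(3)[OF i] xy by (intro d_triangle) auto
    then show ?thesis using le[OF i xy(1)] le[OF i xy(2)] d_commute[of y] by simp
  qed
  then show ?thesis
    unfolding diameter_cost_def using fin k_pos by auto
qed

text \<open>The output is compared with an arbitrary feasible \<open>C\<close>; passing to the
  infimum is left to the end.\<close>

lemma algorithm_correct:
  assumes run: "run algorithm (input n G d k) s" and C: "connected_partition G k C"
  obtains b where "clustered (output_center s) (vec s ''cluster'') b" "supp s ''cluster'' = {..<n}"
    "b \<le> (log 2 (real k) + 1) * growth (diameter_cost d k C)"
proof -
  let ?i = "input n G d k"
  have i: "holds_instance ?i" by (auto simp: holds_instance_def input_def)
  from run obtain s1 where r1: "run search ?i s1"
    and r: "run (If (positive (Scalar ''found''))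
     (Seq (set_rscalar ''rho'' (RScalar ''best'')) (Seq greedy
       (Seq fill_up (Seq singletons decompose)))) Skip) s1 s" unfolding algorithm_def by auto
  note u1 = run_unchanged[OF r1, simplified]
  have h1: "holds_instance s1" using holds_instance_unchanged[OF i u1] by simp
  have inv: "search_inv ({..<n} \<times> {..<n}) s1"
    by (rule search_correct[OF i r1]) (simp add: input_def)
  define rho where "rho = rmem s1 (''best'', 0, 0)"
  obtain x y where xy: "x < n" "y < n" "diameter_cost d k C = d x y"
    using diameter_cost_attained[OF C] .
  \<comment> \<open>The diameter of \<open>C\<close> passes the greedy test, so the search succeeds
    with a radius no larger than it.\<close>
  have "card (greedy_set (d x y) n) \<le> k"
    using card_greedy_set[OF C] diameter_cost_ge[OF C] xy by simp
  then have found: "0 < nmem s1 (''found'', 0, 0)" and le: "rho \<le> diameter_cost d k C"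
    using inv xy unfolding search_inv_def rho_def by auto
  then have rho: "0 \<le> rho" "card (greedy_set rho n) \<le> k"
    using inv unfolding search_inv_def rho_def by auto
  let ?s2 = "s1\<lparr>rmem := (rmem s1)((''rho'', 0, 0) := rho)\<rparr>"
  from r found obtain s3 s4 s5 where r3: "run greedy ?s2 s3" and r4: "run fill_up s3 s4"
    and r5: "run singletons s4 s5" and r6: "run decompose s5 s" by (auto simp: rho_def)
  note u3 = run_unchanged[OF r3, simplified] and u4 = run_unchanged[OF r4, simplified]
    and u5 = run_unchanged[OF r5, simplified] and u6 = run_unchanged[OF r6, simplified]
  have h2: "holds_instance ?s2" using h1 by (simp add: holds_instance_def)
  have h3: "holds_instance s3" using holds_instance_unchanged[OF h2 u3] by simp
  have h4: "holds_instance s4" using holds_instance_unchanged[OF h3 u4] by simp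
  have h5: "holds_instance s5" using holds_instance_unchanged[OF h4 u5] by simp
  have g: "nmem s3 (''m'', 0, 0) = card (greedy_set rho n)" "supp s3 ''idx'' = greedy_set rho n"
    "bij_betw (vec s3 ''idx'') (greedy_set rho n) {1..card (greedy_set rho n)}"
    using greedy_correct[OF h2 r3, of rho] rho by auto
  note kn = connected_partition_k_le[OF C]
  define S where "S = supp s4 ''idx''"
  have f: "greedy_set rho n \<subseteq> S" "bij_betw (vec s4 ''idx'') S {1..k}"
    using fill_up_correct[OF h3 r4 kn] g rho unfolding S_def by auto
  let ?z = "\<lambda>i. nmem s5 (''center'', i, 0)"
  have c: "supp s5 ''cluster'' = S" "supp s5 ''alive'' = S" "clustered ?z (vec s5 ''cluster'') 0"
    using singletons_correct[OF h4 r5] f(2) unfolding S_def by auto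
  have S: "S \<subseteq> {..<n}" unfolding S_def using supp_less(1) .
  have "card S = k" using bij_betw_same_card[OF f(2)] by simp
  moreover have "rho = rmem s5 (''rho'', 0, 0)"
    using unchangedD(2)[OF u3] unchangedD(2)[OF u4] unchangedD(2)[OF u5] by simp
  \<comment> \<open>All centers are still ungrouped, so the condition on components is vacuous, and
    singletons have radius 0.\<close>
  moreover have "covering_inv rho S ?z 0 s5" using c by (simp add: covering_inv_def)
  ultimately have cov: "covering_inv rho S ?z ((log 2 (real k) + 1) * growth rho) s"
      and alive: "supp s ''alive'' = {}"
    using decompose_correct[OF h5 r6 _ rho(1) S _ kn] by auto
  have z: "output_center s = ?z"
    using unchangedD(1)[OF u6] by (auto simp: output_center_def fun_eq_iff)
  \<comment> \<open>The greedy points alone cover everything, and after the layers the components of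
    all centers are labelled.\<close>
  have "{..<n} \<subseteq> \<Union> (comp rho ` S)"
    using greedy_set_covers[OF rho(1) order_refl] f(1) by blast
  also have "\<dots> \<subseteq> supp s ''cluster''" using cov alive by (auto simp: covering_inv_def)
  finally have all: "supp s ''cluster'' = {..<n}" using supp_less(1)[of s "''cluster''"] by blast
  have "growth rho \<le> growth (diameter_cost d k C)"
    unfolding growth_def using le k_pos by (intro mult_right_mono) auto
  then have "(log 2 (real k) + 1) * growth rho \<le> (log 2 (real k) + 1) * growth (diameter_cost d k C)"
    using k_pos by (intro mult_left_mono) auto
  with cov all z show ?thesis
    by (intro that[of "(log 2 (real k) + 1) * growth rho"]) (auto simp: covering_inv_def)
qed

end

section \<open>The approximation ratio for both problems\<close>

definition ratio :: "nat \<Rightarrow> real" where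
  "ratio k = 2 * (log 2 (real k) + 1) * (4 * log 2 (real k) + 2)"

lemma ratio_pos: "1 \<le> k \<Longrightarrow> 0 < ratio k"
  unfolding ratio_def by (intro mult_pos_pos add_nonneg_pos) auto

text \<open>The bound is asymptotic: for \<open>k = 1\<close> the ratio is 4 while the logarithm
  vanishes.\<close>

lemma ratio_bigo: "ratio \<in> O(\<lambda>k. (ln (real k))\<^sup>2)"
  unfolding ratio_def[abs_def] by real_asymp

text \<open>The factor 2 in \<open>ratio\<close> is the passage from radius to diameter of the
  output. For \<open>k\<close>-center it remains on the left, to be cancelled because the diameter
  of a solution is at most twice its radius.\<close>

lemma (in clustering) algorithm_approximates:
  assumes "run algorithm (input n G d k) s" "connected_partition G k C"
  shows "centered_partition G k (output_cluster n s) (output_center s)"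
    and "2 * center_cost d k (output_cluster n s) (output_center s) \<le> ratio k * diameter_cost d k C"
    and "diameter_cost d k (output_cluster n s) \<le> ratio k * diameter_cost d k C"
proof -
  obtain b where b: "clustered (output_center s) (vec s ''cluster'') b" "supp s ''cluster'' = {..<n}"
    "b \<le> (log 2 (real k) + 1) * growth (diameter_cost d k C)"
    using algorithm_correct[OF assms] .
  have out: "output_cluster n s = part (vec s ''cluster'')"
    by (auto simp: output_cluster_def vec_def fun_eq_iff)
  have "0 < vec s ''cluster'' x" if "x < n" for x using b(2) that by (simp add: vec_pos_iff)
  note c = centered_partition_clustered[OF b(1) this]
  show "centered_partition G k (output_cluster n s) (output_center s)"
    unfolding out using c(1) by simp
  have "2 * b \<le> ratio k * diameter_cost d k C"
    using b(3) by (simp add: ratio_def growth_def algebra_simps)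
  then show "2 * center_cost d k (output_cluster n s) (output_center s) \<le> ratio k * diameter_cost d k C"
    "diameter_cost d k (output_cluster n s) \<le> ratio k * diameter_cost d k C"
    unfolding out using c(2,3) by auto
qed

lemma approximates_center_algorithm: "approximates_center algorithm ratio"
  unfolding approximates_center_def
proof (intro allI impI, elim conjE exE)
  fix n G d k t s C c
  assume inst: "clustering_instance G d k" "pverts G = {..<n}" and C: "centered_partition G k C c"
    and "exec algorithm (input n G d k) t s"
  then have run: "run algorithm (input n G d k) s" by (auto simp: run_def)
  interpret clustering n G d k using inst by unfold_locales
  note r = ratio_pos[OF k_pos]
  let ?cost = "center_cost d k (output_cluster n s) (output_center s)"
  have le: "?cost \<le> ratio k * center_cost d k C' c'" if C': "centered_partition G k C' c'" for C' c'
  proof -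
    have "2 * ?cost \<le> ratio k * diameter_cost d k C'"
      using algorithm_approximates(2)[OF run] C' by (simp add: centered_partition_def)
    also have "\<dots> \<le> ratio k * (2 * center_cost d k C' c')"
      using diameter_cost_le_center_cost[OF C'] r by (intro mult_left_mono) auto
    finally show ?thesis by simp
  qed
  \<comment> \<open>Division by the positive ratio turns the comparison with every solution into a
    lower bound on the infimum, so no optimal solution has to be exhibited.\<close>
  have "?cost / ratio k \<le> center_opt G d k"
    unfolding center_opt_def using C le r
    by (intro cInf_greatest) (auto simp: divide_le_eq mult.commute)
  then show "centered_partition G k (output_cluster n s) (output_center s) \<and>
      ?cost \<le> ratio k * center_opt G d k"
    using algorithm_approximates(1)[OF run] C r
    by (auto simp: divide_le_eq mult.commute centered_partition_def)
qed

lemma approximates_diameter_algorithm: "approximates_diameter algorithm ratio"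
  unfolding approximates_diameter_def
proof (intro allI impI, elim conjE exE)
  fix n G d k t s C
  assume inst: "clustering_instance G d k" "pverts G = {..<n}" and C: "connected_partition G k C"
    and "exec algorithm (input n G d k) t s"
  then have run: "run algorithm (input n G d k) s" by (auto simp: run_def)
  interpret clustering n G d k using inst by unfold_locales
  note r = ratio_pos[OF k_pos]
  let ?cost = "diameter_cost d k (output_cluster n s)"
  have "?cost / ratio k \<le> diameter_opt G d k"
    unfolding diameter_opt_def using C algorithm_approximates(3)[OF run] r
    by (intro cInf_greatest) (auto simp: divide_le_eq mult.commute)
  then show "connected_partition G k (output_cluster n s) \<and> ?cost \<le> ratio k * diameter_opt G d k"
    using algorithm_approximates(1)[OF run C] r
    by (auto simp: divide_le_eq mult.commute centered_partition_def)
qed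

theorem theorem18:
  shows "(\<exists>P \<alpha>. polynomial_time P \<and> approximates_center P \<alpha> \<and>
            \<alpha> \<in> O(\<lambda>k. (ln (real k))\<^sup>2)) \<and>
         (\<exists>P \<alpha>. polynomial_time P \<and> approximates_diameter P \<alpha> \<and>
            \<alpha> \<in> O(\<lambda>k. (ln (real k))\<^sup>2))"
  \<comment> \<open>The same program and the same ratio witness both halves.\<close>
  using polynomial_time_algorithm approximates_center_algorithm approximates_diameter_algorithm
    ratio_bigo by blast

end
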